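(* Let $(E,\rho,[\cdot,\cdot]_E,L)$ be a regular local pre-Leibniz algebroid with a locality projector $\mathcal{P}$. For any linear $E$-connection $\nabla$ (not necessarily admissible) and all $u,v,w\in\mathfrak{X}(E)$, $$\nabla^2_{u,v}w-\nabla^2_{v,u}w=R(\nabla)(u,v)w-\nabla_{T(\nabla)(u,v)}w+\nabla_{(1-\mathcal{P})L(e^a,\nabla_{X_a}u,v)}w .$$
   Context: Everything is smooth. $M$ is a manifold, $E\to M$ a real vector bundle of constant rank, $\mathfrak{X}(E)=\Gamma(E)$, $\Omega^1(E)=\Gamma(E^* )$. An anchored vector bundle $(E,\rho)$ has a vector bundle morphism $\rho:E\to T(M)$ over the identity; it is regular if $\ker\rho$ has locally constant rank. A pre-Leibniz algebroid $(E,\rho,[\cdot,\cdot]_E)$ is an anchored vector bundle with an $\mathbb{R}$-bilinear bracket on $\mathfrak{X}(E)$ satisfying $[u,fv]_E=\rho(u)(f)v+f[u,v]_E$ and $\rho([u,v]_E)=[\rho(u),\rho(v)]$. It is local with locality operator $L$, a $C^\infty(M,\mathbb{R})$-multilinear map $L:\Omega^1(E)\times\mathfrak{X}(E)\times\mathfrak{X}(E)\to\mathfrak{X}(E)$, if $[fu,v]_E=-\rho(v)(f)u+f[u,v]_E+L(Df,u,v)$, where $(Df)(u):=\rho(u)(f)$. A locality projector is a $C^\infty(M,\mathbb{R})$-linear map $\mathcal{P}:\mathfrak{X}(E)\to\mathfrak{X}(E)$ such that the image of $\hat L:=\mathcal{P}L$ lies in $\ker\rho$ and $\mathcal{P}$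 restricts to the identity on $\ker\rho$. A linear $E$-connection is an $\mathbb{R}$-bilinear map $\nabla:\mathfrak{X}(E)\times\mathfrak{X}(E)\to\mathfrak{X}(E)$ with $\nabla_u(fv)=\rho(u)(f)v+f\nabla_uv$ and $\nabla_{fu}v=f\nabla_uv$. $(X_a)$ denotes a local frame of $E$, $(e^a)$ the dual coframe, repeated indices are summed; $L(e^a,\nabla_{X_a}u,v)$ does not depend on the frame. $E$-torsion: $T(\nabla)(u,v):=\nabla_uv-\nabla_vu-[u,v]_E+L(e^a,\nabla_{X_a}u,v)$. $E$-curvature: $R(\nabla)(u,v)w:=\nabla_u\nabla_vw-\nabla_v\nabla_uw-\nabla_{[u,v]_E}w+\nabla_{\hat L(e^a,\nabla_{X_a}u,v)}w$. Second order covariant derivative: $\nabla^2_{u,v}w:=\nabla_u\nabla_vw-\nabla_{\nabla_uv}w$. *)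

theory Defs
  imports "HOL-Analysis.Analysis" "HOL-Library.Function_Algebras"
begin

section \<open>Pointwise vector space structure on functions\<close>

text \<open>
  With this instance, sections (functions on the base) and linear functionals can be added,
  subtracted and multiplied by real scalars pointwise.
\<close>

instantiation "fun" :: (type, real_vector) real_vector
begin

definition scaleR_fun :: "real \<Rightarrow> ('a \<Rightarrow> 'b) \<Rightarrow> 'a \<Rightarrow> 'b"
  where "scaleR_fun c f = (\<lambda>x. c *\<^sub>R f x)"

instance
  by standard (auto simp: scaleR_fun_def plus_fun_def fun_eq_iff algebra_simps)

end

definition fun_smult :: "('m \<Rightarrow> real) \<Rightarrow> ('m \<Rightarrow> 'v::real_vector) \<Rightarrow> 'm \<Rightarrow> 'v"  (infixr \<open>\<odot>\<close> 75)
  where "f \<odot> u = (\<lambda>p. f p *\<^sub>R u p)"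


section \<open>Smooth maps and smooth manifolds\<close>

text \<open>
  The model spaces are real inner product spaces of finite dimension. Unlike the class
  \<open>euclidean_space\<close>, this admits dimension (and, for bundles, rank) zero.
\<close>

definition fin_dim :: "'b::real_vector itself \<Rightarrow> bool"
  where "fin_dim _ \<longleftrightarrow> (\<exists>B::'b set. finite B \<and> span B = UNIV)"

text \<open>
  \<open>k\<close> times continuously differentiable on an open set: all directional derivatives are
  \<open>k - 1\<close> times continuously differentiable. This is the usual notion because the
  domain is always finite-dimensional.
\<close>

primrec Ck_on :: "nat \<Rightarrow> 'a::real_normed_vector set \<Rightarrow> ('a \<Rightarrow> 'c::real_normed_vector) \<Rightarrow> bool"
  where
    "Ck_on 0 S f \<longleftrightarrow> continuous_on S f"
  | "Ck_on (Suc k) S f \<longleftrightarrow>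
       (\<exists>D. (\<forall>x\<in>S. (f has_derivative D x) (at x)) \<and> (\<forall>v. Ck_on k S (\<lambda>x. D x v)))"

definition smooth_on :: "'a::real_normed_vector set \<Rightarrow> ('a \<Rightarrow> 'c::real_normed_vector) \<Rightarrow> bool"
  where "smooth_on S f \<longleftrightarrow> (\<forall>k. Ck_on k S f)"

type_synonym ('m, 'b) atlas = "('m set \<times> ('m \<Rightarrow> 'b)) set"

text \<open>
  The manifold is the whole type \<open>'m\<close>, Hausdorff and second countable by its type class.
  Its smooth structure is the one generated by the atlas, which need not be maximal.
\<close>

definition smooth_manifold ::
    "('m::{t2_space, second_countable_topology}, 'b::real_inner) atlas \<Rightarrow> bool"
  where "smooth_manifold A \<longleftrightarrow>
    fin_dim TYPE('b) \<and>
    (\<Union>(U, \<phi>)\<in>A. U) = UNIV \<and>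
    (\<forall>(U, \<phi>)\<in>A. open U \<and> open (\<phi> ` U) \<and>
        homeomorphism U (\<phi> ` U) \<phi> (inv_into U \<phi>)) \<and>
    (\<forall>(U, \<phi>)\<in>A. \<forall>(V, \<psi>)\<in>A. smooth_on (\<phi> ` (U \<inter> V)) (\<psi> \<circ> inv_into U \<phi>))"

definition smooth_map_on ::
    "('m, 'b::real_inner) atlas \<Rightarrow> 'm set \<Rightarrow> ('m \<Rightarrow> 'c::real_normed_vector) \<Rightarrow> bool"
  where "smooth_map_on A W f \<longleftrightarrow>
    (\<forall>(U, \<phi>)\<in>A. smooth_on (\<phi> ` (U \<inter> W)) (f \<circ> inv_into U \<phi>))"

definition Cinf :: "('m, 'b::real_inner) atlas \<Rightarrow> ('m \<Rightarrow> real) set"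
  where "Cinf A = {f. smooth_map_on A UNIV f}"


section \<open>Vector bundles\<close>

text \<open>
  A bundle is a family of vector spaces \<open>fib E p\<close> together with local trivialisations
  \<open>(U, \<tau>)\<close>, where \<open>\<tau> p\<close> is a linear isomorphism from \<open>fib E p\<close>
  onto the model fibre \<open>'f\<close> for all \<open>p\<close> in \<open>U\<close>. The total space is the disjoint
  union of the fibres, with the topology and the smooth structure given by the trivialisations.
  The fibres are linear subspaces of some real vector space \<open>'v\<close> merely to have
  their operations at hand: \<open>'v\<close> carries no topology and is not related to the
  trivialisations, so that \<open>E\<close> is not a subbundle of a product bundle, and every vector
  bundle is of this form up to isomorphism. The rank is the dimension of \<open>'f\<close>.
\<close>

record ('m, 'v, 'f) vbundle =
  fib :: "'m \<Rightarrow> 'v set"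
  trv :: "('m set \<times> ('m \<Rightarrow> 'v \<Rightarrow> 'f)) set"

definition linear_over :: "'v::real_vector set \<Rightarrow> ('v \<Rightarrow> 'w::real_vector) \<Rightarrow> bool"
  where "linear_over S h \<longleftrightarrow>
    (\<forall>x\<in>S. \<forall>y\<in>S. h (x + y) = h x + h y) \<and> (\<forall>c. \<forall>x\<in>S. h (c *\<^sub>R x) = c *\<^sub>R h x)"

definition vector_bundle ::
    "('m::topological_space, 'b::real_inner) atlas \<Rightarrow> ('m, 'v::real_vector, 'f::real_inner) vbundle \<Rightarrow> bool"
  where "vector_bundle A E \<longleftrightarrow>
    fin_dim TYPE('f) \<and>
    (\<forall>p. subspace (fib E p)) \<and>
    (\<Union>(U, \<tau>)\<in>trv E. U) = UNIV \<and>
    (\<forall>(U, \<tau>)\<in>trv E. open U \<and>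
        (\<forall>p\<in>U. linear_over (fib E p) (\<tau> p) \<and> bij_betw (\<tau> p) (fib E p) UNIV)) \<and>
    (\<forall>(U, \<tau>)\<in>trv E. \<forall>(V, \<sigma>)\<in>trv E. \<forall>c.
        smooth_map_on A (U \<inter> V) (\<lambda>p. \<sigma> p (inv_into (fib E p) (\<tau> p) c)))"

definition vb_rank :: "('m, 'v, 'f::real_vector) vbundle \<Rightarrow> nat"
  where "vb_rank E = dim (UNIV :: 'f set)"

definition local_section ::
    "('m, 'b::real_inner) atlas \<Rightarrow> ('m, 'v, 'f::real_inner) vbundle \<Rightarrow> 'm set \<Rightarrow> ('m \<Rightarrow> 'v) \<Rightarrow> bool"
  where "local_section A E W u \<longleftrightarrow>
    (\<forall>p\<in>W. u p \<in> fib E p) \<and>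
    (\<forall>(U, \<tau>)\<in>trv E. smooth_map_on A (U \<inter> W) (\<lambda>p. \<tau> p (u p)))"

definition sections ::
    "('m, 'b::real_inner) atlas \<Rightarrow> ('m, 'v, 'f::real_inner) vbundle \<Rightarrow> ('m \<Rightarrow> 'v) set"
  where "sections A E = {u. local_section A E UNIV u}"

text \<open>
  Smooth vector bundle morphisms over the identity. Smoothness is expressed in
  trivialisations, where the morphism is a map into linear maps between the model fibres.
\<close>

definition vb_morphism ::
    "('m, 'b::real_inner) atlas \<Rightarrow> ('m, 'v::real_vector, 'f::real_inner) vbundle \<Rightarrow>
     ('m, 'w::real_vector, 'g::real_inner) vbundle \<Rightarrow> ('m \<Rightarrow> 'v \<Rightarrow> 'w) \<Rightarrow> bool"
  where "vb_morphism A E F h \<longleftrightarrow>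
    (\<forall>p. h p ` fib E p \<subseteq> fib F p \<and> linear_over (fib E p) (h p)) \<and>
    (\<forall>(U, \<tau>)\<in>trv E. \<forall>(V, \<sigma>)\<in>trv F. \<forall>c.
        smooth_map_on A (U \<inter> V) (\<lambda>p. \<sigma> p (h p (inv_into (fib E p) (\<tau> p) c))))"

text \<open>
  A linear functional on a fibre is extended by zero outside the fibre. The model fibre is
  identified with its dual by the inner product.
\<close>

definition dual_bundle ::
    "('m, 'v::real_vector, 'f::real_inner) vbundle \<Rightarrow> ('m, 'v \<Rightarrow> real, 'f) vbundle"
  where "dual_bundle E =
    \<lparr>fib = (\<lambda>p. {\<alpha>. linear_over (fib E p) \<alpha> \<and> (\<forall>x. x \<notin> fib E p \<longrightarrow> \<alpha> x = 0)}),
     trv = (\<lambda>(U, \<tau>). (U, \<lambda>p \<alpha>. THE c. \<forall>x\<in>fib E p. \<alpha> x = c \<bullet> \<tau> p x)) ` trv E\<rparr>"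

text \<open>
  Tangent vectors at \<open>p\<close> are the derivations at \<open>p\<close>; they are set to zero on functions that are
  not smooth, in order to be determined by their values on smooth functions. A chart
  \<open>(U, \<phi>)\<close> assigns to a tangent vector its coordinate vector \<open>c\<close>.
\<close>

definition tangent_space ::
    "('m, 'b::real_inner) atlas \<Rightarrow> 'm \<Rightarrow> (('m \<Rightarrow> real) \<Rightarrow> real) set"
  where "tangent_space A p =
    {D. linear_over (Cinf A) D \<and>
        (\<forall>f\<in>Cinf A. \<forall>g\<in>Cinf A. D (\<lambda>x. f x * g x) = f p * D g + g p * D f) \<and>
        (\<forall>f. f \<notin> Cinf A \<longrightarrow> D f = 0)}"

definition tangent_bundle ::
    "('m, 'b::real_inner) atlas \<Rightarrow> ('m, ('m \<Rightarrow> real) \<Rightarrow> real, 'b) vbundle"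
  where "tangent_bundle A =
    \<lparr>fib = tangent_space A,
     trv = (\<lambda>(U, \<phi>). (U, \<lambda>p D. THE c. \<forall>f\<in>Cinf A.
              D f = frechet_derivative (f \<circ> inv_into U \<phi>) (at (\<phi> p)) c)) ` A\<rparr>"


section \<open>Local pre-Leibniz algebroids\<close>

definition Cinf_linear_on ::
    "('m, 'b::real_inner) atlas \<Rightarrow> ('m \<Rightarrow> 'v::real_vector) set \<Rightarrow> (('m \<Rightarrow> 'v) \<Rightarrow> 'm \<Rightarrow> 'w::real_vector) \<Rightarrow> bool"
  where "Cinf_linear_on A S h \<longleftrightarrow>
    (\<forall>u\<in>S. \<forall>v\<in>S. h (u + v) = h u + h v) \<and> (\<forall>f\<in>Cinf A. \<forall>u\<in>S. h (f \<odot> u) = f \<odot> h u)"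

definition anchored_vector_bundle ::
    "('m::topological_space, 'b::real_inner) atlas \<Rightarrow> ('m, 'v::real_vector, 'f::real_inner) vbundle \<Rightarrow>
     ('m \<Rightarrow> 'v \<Rightarrow> ('m \<Rightarrow> real) \<Rightarrow> real) \<Rightarrow> bool"
  where "anchored_vector_bundle A E \<rho> \<longleftrightarrow>
    vector_bundle A E \<and> vb_morphism A E (tangent_bundle A) \<rho>"

text \<open>The function \<open>\<rho>(u)(f)\<close> on the base.\<close>

definition anchor_deriv ::
    "('m \<Rightarrow> 'v \<Rightarrow> ('m \<Rightarrow> real) \<Rightarrow> real) \<Rightarrow> ('m \<Rightarrow> 'v) \<Rightarrow> ('m \<Rightarrow> real) \<Rightarrow> 'm \<Rightarrow> real"
  where "anchor_deriv \<rho> u f = (\<lambda>p. \<rho> p (u p) f)"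

definition anchor_kernel ::
    "('m, 'v, 'f) vbundle \<Rightarrow> ('m \<Rightarrow> 'v \<Rightarrow> ('m \<Rightarrow> real) \<Rightarrow> real) \<Rightarrow> 'm \<Rightarrow> 'v set"
  where "anchor_kernel E \<rho> p = {x \<in> fib E p. \<rho> p x = 0}"

definition regular_anchor ::
    "('m::topological_space, 'v::real_vector, 'f) vbundle \<Rightarrow> ('m \<Rightarrow> 'v \<Rightarrow> ('m \<Rightarrow> real) \<Rightarrow> real) \<Rightarrow> bool"
  where "regular_anchor E \<rho> \<longleftrightarrow>
    (\<forall>p. \<exists>U k. open U \<and> p \<in> U \<and> (\<forall>q\<in>U. dim (anchor_kernel E \<rho> q) = k))"

definition pre_Leibniz_algebroid ::
    "('m::topological_space, 'b::real_inner) atlas \<Rightarrow> ('m, 'v::real_vector, 'f::real_inner) vbundle \<Rightarrow>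
     ('m \<Rightarrow> 'v \<Rightarrow> ('m \<Rightarrow> real) \<Rightarrow> real) \<Rightarrow> (('m \<Rightarrow> 'v) \<Rightarrow> ('m \<Rightarrow> 'v) \<Rightarrow> 'm \<Rightarrow> 'v) \<Rightarrow> bool"
  where "pre_Leibniz_algebroid A E \<rho> br \<longleftrightarrow>
    (let \<Gamma> = sections A E in
      anchored_vector_bundle A E \<rho> \<and>
      (\<forall>u\<in>\<Gamma>. \<forall>v\<in>\<Gamma>. br u v \<in> \<Gamma>) \<and>
      (\<forall>u\<in>\<Gamma>. linear_over \<Gamma> (\<lambda>v. br u v)) \<and>
      (\<forall>v\<in>\<Gamma>. linear_over \<Gamma> (\<lambda>u. br u v)) \<and>
      (\<forall>f\<in>Cinf A. \<forall>u\<in>\<Gamma>. \<forall>v\<in>\<Gamma>. br u (f \<odot> v) = anchor_deriv \<rho> u f \<odot> v + f \<odot> br u v) \<and>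
      (\<forall>u\<in>\<Gamma>. \<forall>v\<in>\<Gamma>. \<forall>f\<in>Cinf A.
         anchor_deriv \<rho> (br u v) f =
         anchor_deriv \<rho> u (anchor_deriv \<rho> v f) - anchor_deriv \<rho> v (anchor_deriv \<rho> u f)))"

definition anchor_differential ::
    "('m, 'v, 'f) vbundle \<Rightarrow> ('m \<Rightarrow> 'v \<Rightarrow> ('m \<Rightarrow> real) \<Rightarrow> real) \<Rightarrow> ('m \<Rightarrow> real) \<Rightarrow> 'm \<Rightarrow> 'v \<Rightarrow> real"
  where "anchor_differential E \<rho> f = (\<lambda>p x. if x \<in> fib E p then \<rho> p x f else 0)"

definition local_pre_Leibniz_algebroid ::
    "('m::topological_space, 'b::real_inner) atlas \<Rightarrow> ('m, 'v::real_vector, 'f::real_inner) vbundle \<Rightarrow>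
     ('m \<Rightarrow> 'v \<Rightarrow> ('m \<Rightarrow> real) \<Rightarrow> real) \<Rightarrow> (('m \<Rightarrow> 'v) \<Rightarrow> ('m \<Rightarrow> 'v) \<Rightarrow> 'm \<Rightarrow> 'v) \<Rightarrow>
     (('m \<Rightarrow> 'v \<Rightarrow> real) \<Rightarrow> ('m \<Rightarrow> 'v) \<Rightarrow> ('m \<Rightarrow> 'v) \<Rightarrow> 'm \<Rightarrow> 'v) \<Rightarrow> bool"
  where "local_pre_Leibniz_algebroid A E \<rho> br L \<longleftrightarrow>
    (let \<Gamma> = sections A E; \<Omega> = sections A (dual_bundle E) in
      pre_Leibniz_algebroid A E \<rho> br \<and>
      (\<forall>\<omega>\<in>\<Omega>. \<forall>u\<in>\<Gamma>. \<forall>v\<in>\<Gamma>. L \<omega> u v \<in> \<Gamma>) \<and>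
      (\<forall>u\<in>\<Gamma>. \<forall>v\<in>\<Gamma>. Cinf_linear_on A \<Omega> (\<lambda>\<omega>. L \<omega> u v)) \<and>
      (\<forall>\<omega>\<in>\<Omega>. \<forall>v\<in>\<Gamma>. Cinf_linear_on A \<Gamma> (\<lambda>u. L \<omega> u v)) \<and>
      (\<forall>\<omega>\<in>\<Omega>. \<forall>u\<in>\<Gamma>. Cinf_linear_on A \<Gamma> (\<lambda>v. L \<omega> u v)) \<and>
      (\<forall>f\<in>Cinf A. \<forall>u\<in>\<Gamma>. \<forall>v\<in>\<Gamma>.
         br (f \<odot> u) v =
         - (anchor_deriv \<rho> v f \<odot> u) + f \<odot> br u v + L (anchor_differential E \<rho> f) u v))"

definition L_hat ::
    "(('m \<Rightarrow> 'v) \<Rightarrow> 'm \<Rightarrow> 'v) \<Rightarrow> (('m \<Rightarrow> 'v \<Rightarrow> real) \<Rightarrow> ('m \<Rightarrow> 'v) \<Rightarrow> ('m \<Rightarrow> 'v) \<Rightarrow> 'm \<Rightarrow> 'v) \<Rightarrow>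
     ('m \<Rightarrow> 'v \<Rightarrow> real) \<Rightarrow> ('m \<Rightarrow> 'v) \<Rightarrow> ('m \<Rightarrow> 'v) \<Rightarrow> 'm \<Rightarrow> 'v"
  where "L_hat P L = (\<lambda>\<omega> u v. P (L \<omega> u v))"

definition kernel_sections ::
    "('m, 'b::real_inner) atlas \<Rightarrow> ('m, 'v, 'f::real_inner) vbundle \<Rightarrow>
     ('m \<Rightarrow> 'v \<Rightarrow> ('m \<Rightarrow> real) \<Rightarrow> real) \<Rightarrow> ('m \<Rightarrow> 'v) set"
  where "kernel_sections A E \<rho> = {u \<in> sections A E. \<forall>p. u p \<in> anchor_kernel E \<rho> p}"

definition locality_projector ::
    "('m, 'b::real_inner) atlas \<Rightarrow> ('m, 'v::real_vector, 'f::real_inner) vbundle \<Rightarrow>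
     ('m \<Rightarrow> 'v \<Rightarrow> ('m \<Rightarrow> real) \<Rightarrow> real) \<Rightarrow>
     (('m \<Rightarrow> 'v \<Rightarrow> real) \<Rightarrow> ('m \<Rightarrow> 'v) \<Rightarrow> ('m \<Rightarrow> 'v) \<Rightarrow> 'm \<Rightarrow> 'v) \<Rightarrow> (('m \<Rightarrow> 'v) \<Rightarrow> 'm \<Rightarrow> 'v) \<Rightarrow> bool"
  where "locality_projector A E \<rho> L P \<longleftrightarrow>
    (let \<Gamma> = sections A E; \<Omega> = sections A (dual_bundle E) in
      (\<forall>u\<in>\<Gamma>. P u \<in> \<Gamma>) \<and>
      Cinf_linear_on A \<Gamma> P \<and>
      (\<forall>\<omega>\<in>\<Omega>. \<forall>u\<in>\<Gamma>. \<forall>v\<in>\<Gamma>. L_hat P L \<omega> u v \<in> kernel_sections A E \<rho>) \<and>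
      (\<forall>u\<in>kernel_sections A E \<rho>. P u = u))"


section \<open>Connections, torsion and curvature\<close>

definition E_connection ::
    "('m, 'b::real_inner) atlas \<Rightarrow> ('m, 'v::real_vector, 'f::real_inner) vbundle \<Rightarrow>
     ('m \<Rightarrow> 'v \<Rightarrow> ('m \<Rightarrow> real) \<Rightarrow> real) \<Rightarrow> (('m \<Rightarrow> 'v) \<Rightarrow> ('m \<Rightarrow> 'v) \<Rightarrow> 'm \<Rightarrow> 'v) \<Rightarrow> bool"
  where "E_connection A E \<rho> nabla \<longleftrightarrow>
    (let \<Gamma> = sections A E in
      (\<forall>u\<in>\<Gamma>. \<forall>v\<in>\<Gamma>. nabla u v \<in> \<Gamma>) \<and>
      (\<forall>u\<in>\<Gamma>. linear_over \<Gamma> (\<lambda>v. nabla u v)) \<and>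
      (\<forall>v\<in>\<Gamma>. linear_over \<Gamma> (\<lambda>u. nabla u v)) \<and>
      (\<forall>f\<in>Cinf A. \<forall>u\<in>\<Gamma>. \<forall>v\<in>\<Gamma>.
         nabla u (f \<odot> v) = anchor_deriv \<rho> u f \<odot> v + f \<odot> nabla u v) \<and>
      (\<forall>f\<in>Cinf A. \<forall>u\<in>\<Gamma>. \<forall>v\<in>\<Gamma>. nabla (f \<odot> u) v = f \<odot> nabla u v))"

definition local_frame ::
    "('m::topological_space, 'b::real_inner) atlas \<Rightarrow> ('m, 'v::real_vector, 'f::real_inner) vbundle \<Rightarrow>
     'm set \<Rightarrow> (nat \<Rightarrow> 'm \<Rightarrow> 'v) \<Rightarrow> bool"
  where "local_frame A E U X \<longleftrightarrow>
    open U \<and> (\<forall>a<vb_rank E. local_section A E U (X a)) \<and>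
    (\<forall>p\<in>U. inj_on (\<lambda>a. X a p) {..<vb_rank E} \<and>
       independent ((\<lambda>a. X a p) ` {..<vb_rank E}) \<and>
       span ((\<lambda>a. X a p) ` {..<vb_rank E}) = fib E p)"

definition dual_coframe ::
    "('m::topological_space, 'b::real_inner) atlas \<Rightarrow> ('m, 'v::real_vector, 'f::real_inner) vbundle \<Rightarrow>
     'm set \<Rightarrow> (nat \<Rightarrow> 'm \<Rightarrow> 'v) \<Rightarrow> (nat \<Rightarrow> 'm \<Rightarrow> 'v \<Rightarrow> real) \<Rightarrow> bool"
  where "dual_coframe A E U X e \<longleftrightarrow>
    (\<forall>a<vb_rank E. local_section A (dual_bundle E) U (e a)) \<and>
    (\<forall>p\<in>U. \<forall>a<vb_rank E. \<forall>b<vb_rank E. e a p (X b p) = (if a = b then 1 else 0))"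

text \<open>
  The contraction \<open>B(e\<^sup>a, X\<^sub>a)\<close> of a \<open>C\<^sup>\<infinity>\<close>-bilinear map
  \<open>B\<close>. Such a map is defined on global sections only and is evaluated on a local frame
  in the usual way: its value at \<open>p\<close> is obtained from global sections which agree with the
  given local ones near \<open>p\<close>. The value depends neither on these nor on the frame.
\<close>

definition frame_contraction ::
    "('m::topological_space, 'b::real_inner) atlas \<Rightarrow> ('m, 'v::real_vector, 'f::real_inner) vbundle \<Rightarrow>
     (('m \<Rightarrow> 'v \<Rightarrow> real) \<Rightarrow> ('m \<Rightarrow> 'v) \<Rightarrow> 'm \<Rightarrow> 'v) \<Rightarrow> 'm \<Rightarrow> 'v"
  where "frame_contraction A E B = (\<lambda>p. THE y. \<forall>U X e X' e'.
    local_frame A E U X \<and> dual_coframe A E U X e \<and> p \<in> U \<and>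
    (\<forall>a<vb_rank E. X' a \<in> sections A E \<and> e' a \<in> sections A (dual_bundle E) \<and>
       (\<forall>\<^sub>F q in nhds p. X' a q = X a q \<and> e' a q = e a q))
    \<longrightarrow> y = (\<Sum>a<vb_rank E. B (e' a) (X' a) p))"

text \<open>The section \<open>L(e\<^sup>a, \<nabla>\<^bsub>X\<^sub>a\<^esub> u, v)\<close>.\<close>

definition L_contraction ::
    "('m::topological_space, 'b::real_inner) atlas \<Rightarrow> ('m, 'v::real_vector, 'f::real_inner) vbundle \<Rightarrow>
     (('m \<Rightarrow> 'v \<Rightarrow> real) \<Rightarrow> ('m \<Rightarrow> 'v) \<Rightarrow> ('m \<Rightarrow> 'v) \<Rightarrow> 'm \<Rightarrow> 'v) \<Rightarrow>
     (('m \<Rightarrow> 'v) \<Rightarrow> ('m \<Rightarrow> 'v) \<Rightarrow> 'm \<Rightarrow> 'v) \<Rightarrow> ('m \<Rightarrow> 'v) \<Rightarrow> ('m \<Rightarrow> 'v) \<Rightarrow> 'm \<Rightarrow> 'v"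
  where "L_contraction A E L nabla u v = frame_contraction A E (\<lambda>\<omega> X. L \<omega> (nabla X u) v)"

definition E_torsion ::
    "('m::topological_space, 'b::real_inner) atlas \<Rightarrow> ('m, 'v::real_vector, 'f::real_inner) vbundle \<Rightarrow>
     (('m \<Rightarrow> 'v) \<Rightarrow> ('m \<Rightarrow> 'v) \<Rightarrow> 'm \<Rightarrow> 'v) \<Rightarrow>
     (('m \<Rightarrow> 'v \<Rightarrow> real) \<Rightarrow> ('m \<Rightarrow> 'v) \<Rightarrow> ('m \<Rightarrow> 'v) \<Rightarrow> 'm \<Rightarrow> 'v) \<Rightarrow>
     (('m \<Rightarrow> 'v) \<Rightarrow> ('m \<Rightarrow> 'v) \<Rightarrow> 'm \<Rightarrow> 'v) \<Rightarrow> ('m \<Rightarrow> 'v) \<Rightarrow> ('m \<Rightarrow> 'v) \<Rightarrow> 'm \<Rightarrow> 'v"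
  where "E_torsion A E br L nabla u v =
    nabla u v - nabla v u - br u v + L_contraction A E L nabla u v"

definition E_curvature ::
    "('m::topological_space, 'b::real_inner) atlas \<Rightarrow> ('m, 'v::real_vector, 'f::real_inner) vbundle \<Rightarrow>
     (('m \<Rightarrow> 'v) \<Rightarrow> ('m \<Rightarrow> 'v) \<Rightarrow> 'm \<Rightarrow> 'v) \<Rightarrow>
     (('m \<Rightarrow> 'v \<Rightarrow> real) \<Rightarrow> ('m \<Rightarrow> 'v) \<Rightarrow> ('m \<Rightarrow> 'v) \<Rightarrow> 'm \<Rightarrow> 'v) \<Rightarrow>
     (('m \<Rightarrow> 'v) \<Rightarrow> 'm \<Rightarrow> 'v) \<Rightarrow>
     (('m \<Rightarrow> 'v) \<Rightarrow> ('m \<Rightarrow> 'v) \<Rightarrow> 'm \<Rightarrow> 'v) \<Rightarrow>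
     ('m \<Rightarrow> 'v) \<Rightarrow> ('m \<Rightarrow> 'v) \<Rightarrow> ('m \<Rightarrow> 'v) \<Rightarrow> 'm \<Rightarrow> 'v"
  where "E_curvature A E br L P nabla u v w =
    nabla u (nabla v w) - nabla v (nabla u w) - nabla (br u v) w
    + nabla (L_contraction A E (L_hat P L) nabla u v) w"

definition second_covariant_derivative ::
    "(('m \<Rightarrow> 'v::real_vector) \<Rightarrow> ('m \<Rightarrow> 'v) \<Rightarrow> 'm \<Rightarrow> 'v) \<Rightarrow>
     ('m \<Rightarrow> 'v) \<Rightarrow> ('m \<Rightarrow> 'v) \<Rightarrow> ('m \<Rightarrow> 'v) \<Rightarrow> 'm \<Rightarrow> 'v"
  where "second_covariant_derivative nabla u v w = nabla u (nabla v w) - nabla (nabla u v) w"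

end

(*
  The identity is linear algebra once the contraction C = L(e^a, nabla_{X_a} u, v) is known to be
  a smooth global section with P C = (P L)(e^a, nabla_{X_a} u, v): then nabla_{P C} w from the
  curvature cancels against the correction term. Both facts are local. Bump functions show that
  C^infinity-linear maps of sections are local operators and extend the frame of a trivialisation
  to global sections; hence B(e^a, X_a) does not depend on the frame, and near each point it is
  the single global section given by the sum of the B(e'^a, X'_a) over such extensions.
*)
theory Submission
  imports Defs
begin

section \<open>Calculus of smooth maps\<close>

text \<open>Two features of the setting shape the work. A bilinear map built from \<open>L\<close>
  accepts global sections only, whereas a frame is given only on an open set. Every computation at a
  point therefore uses global sections that agree with the frame on a neighbourhood. Moreover
  \<open>frame_contraction\<close> is a definite description that quantifies over all frames: it
  determines a value at \<open>p\<close> only once an extended frame at \<open>p\<close> is known to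
  exist and all of them are known to give the same sum.

  The model spaces are merely finite-dimensional inner product spaces, possibly of dimension zero,
  so orthonormal bases and compactness of closed balls are derived here. The inner product also
  identifies a model fibre with its dual. Once the dual is known to be a vector bundle, each
  statement about sections serves \<open>E\<close> and its dual alike; this is how coframes are
  extended and how the 1-form argument of \<open>L\<close> is localised.\<close>

lemma Ck_on_subset:
  assumes "Ck_on k S f" "T \<subseteq> S"
  shows "Ck_on k T f"
  using assms
proof (induction k arbitrary: f)
  case 0
  then show ?case by (auto intro: continuous_on_subset)
next
  case (Suc k)
  then show ?case by (simp, blast)
qed

lemma Ck_on_cong:
  assumes "open S" "\<And>x. x \<in> S \<Longrightarrow> f x = g x" "Ck_on k S f"
  shows "Ck_on k S g"
proof (cases k)
  case 0
  then show ?thesis using assms continuous_on_cong[of S S f g] by simp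
next
  case (Suc j)
  then obtain D where D: "\<And>x. x \<in> S \<Longrightarrow> (f has_derivative D x) (at x)"
      "\<And>v. Ck_on j S (\<lambda>x. D x v)"
    using assms(3) by auto
  have "(g has_derivative D x) (at x)" if "x \<in> S" for x
    using has_derivative_transform_within_open[OF D(1)[OF that] assms(1) that assms(2)] .
  then show ?thesis using D(2) Suc by auto
qed

lemma Ck_on_SucD: "Ck_on (Suc k) S f \<Longrightarrow> Ck_on k S f"
proof (induction k arbitrary: f)
  case 0
  then show ?case
    by (auto intro!: continuous_at_imp_continuous_on dest: has_derivative_continuous)
next
  case (Suc k)
  then obtain D where D: "\<And>x. x \<in> S \<Longrightarrow> (f has_derivative D x) (at x)"
      "\<And>v. Ck_on (Suc k) S (\<lambda>x. D x v)"
    using Ck_on.simps(2) by metis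
  have "Ck_on k S (\<lambda>x. D x v)" for v using Suc.IH[OF D(2)] .
  then show ?case using D(1) by auto
qed

text \<open>Derivatives are taken with respect to the full filter \<open>at x\<close> and are hence
  unique, so the witnesses of all pieces coincide with \<open>frechet_derivative\<close>. This one
  choice then serves the whole union.\<close>

lemma Ck_on_UN:
  assumes "\<And>i. i \<in> I \<Longrightarrow> open (S i)" "\<And>i. i \<in> I \<Longrightarrow> Ck_on k (S i) f"
  shows "Ck_on k (\<Union>i\<in>I. S i) f"
  using assms(2)
proof (induction k arbitrary: f)
  case 0
  then show ?case using assms(1) by (simp add: continuous_on_open_UN)
next
  case (Suc k)
  define D where "D x = frechet_derivative f (at x)" for x
  have *: "(\<forall>x\<in>S i. (f has_derivative D x) (at x)) \<and> (\<forall>v. Ck_on k (S i) (\<lambda>x. D x v))"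
    if i: "i \<in> I" for i
  proof -
    obtain D' where D': "\<And>x. x \<in> S i \<Longrightarrow> (f has_derivative D' x) (at x)"
        "\<And>v. Ck_on k (S i) (\<lambda>x. D' x v)"
      using Suc.prems[OF i] by auto
    have eq: "D' x = D x" if "x \<in> S i" for x
      unfolding D_def using frechet_derivative_at[OF D'(1)[OF that]] .
    have "Ck_on k (S i) (\<lambda>x. D x v)" for v
      by (rule Ck_on_cong[OF assms(1)[OF i] _ D'(2)[of v]]) (simp add: eq)
    then show ?thesis using D'(1) eq by auto
  qed
  have "Ck_on k (\<Union>i\<in>I. S i) (\<lambda>x. D x v)" for v
    using Suc.IH * by blast
  then show ?case using * by auto
qed

lemma Ck_on_const: "Ck_on k S (\<lambda>_. c)"
proof (induction k arbitrary: c)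
  case (Suc k)
  have "\<forall>x\<in>S. ((\<lambda>_. c) has_derivative (\<lambda>_. 0)) (at x)" by simp
  then show ?case using Suc by (auto intro!: exI[of _ "\<lambda>_ _. 0"])
qed simp

lemma Ck_on_ident: "Ck_on k S (\<lambda>x. x)"
  by (cases k) (auto intro!: exI[of _ "\<lambda>_ h. h"] Ck_on_const)

lemma Ck_on_add:
  assumes "Ck_on k S f" "Ck_on k S g"
  shows "Ck_on k S (\<lambda>x. f x + g x)"
  using assms
proof (induction k arbitrary: f g)
  case 0
  then show ?case by (auto intro: continuous_on_add)
next
  case (Suc k)
  from Suc.prems(1) obtain D where D: "\<And>x. x \<in> S \<Longrightarrow> (f has_derivative D x) (at x)"
      "\<And>v. Ck_on k S (\<lambda>x. D x v)"
    by auto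
  from Suc.prems(2) obtain D' where D': "\<And>x. x \<in> S \<Longrightarrow> (g has_derivative D' x) (at x)"
      "\<And>v. Ck_on k S (\<lambda>x. D' x v)"
    by auto
  show ?case
    unfolding Ck_on.simps
    by (rule exI[of _ "\<lambda>x h. D x h + D' x h"])
      (auto intro!: has_derivative_add D D' Suc.IH)
qed

text \<open>A single induction with the Leibniz rule serves products, scalar multiples and inner
  products. Each summand of the derivative keeps one factor undifferentiated, which is why the step
  also needs \<open>f\<close> and \<open>g\<close> at the lower order.\<close>

lemma Ck_on_bilinear:
  assumes "bounded_bilinear B" "Ck_on k S f" "Ck_on k S g"
  shows "Ck_on k S (\<lambda>x. B (f x) (g x))"
  using assms(2,3)
proof (induction k arbitrary: f g)
  case 0
  then show ?case by (auto intro: bounded_bilinear.continuous_on[OF assms(1)])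
next
  case (Suc k)
  from Suc.prems(1) obtain D where D: "\<And>x. x \<in> S \<Longrightarrow> (f has_derivative D x) (at x)"
      "\<And>v. Ck_on k S (\<lambda>x. D x v)"
    by auto
  from Suc.prems(2) obtain D' where D': "\<And>x. x \<in> S \<Longrightarrow> (g has_derivative D' x) (at x)"
      "\<And>v. Ck_on k S (\<lambda>x. D' x v)"
    by auto
  have "Ck_on k S f" "Ck_on k S g"
    using Suc.prems by (auto intro: Ck_on_SucD simp del: Ck_on.simps)
  then show ?case
    unfolding Ck_on.simps
    by (intro exI[of _ "\<lambda>x h. B (f x) (D' x h) + B (D x h) (g x)"])
      (auto intro!: bounded_bilinear.FDERIV[OF assms(1)] D D' Suc.IH Ck_on_add)
qed

lemmas Ck_on_mult = Ck_on_bilinear[OF bounded_bilinear_mult]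
lemmas Ck_on_scaleR = Ck_on_bilinear[OF bounded_bilinear_scaleR]
lemmas Ck_on_inner = Ck_on_bilinear[OF bounded_bilinear_inner]

lemma Ck_on_diff:
  assumes "Ck_on k S f" "Ck_on k S g"
  shows "Ck_on k S (\<lambda>x. f x - g x)"
  using Ck_on_add[OF assms(1) Ck_on_scaleR[OF Ck_on_const[of k S "-1"] assms(2)]] by simp

text \<open>With a real variable in the middle, the chain rule \<open>D (f x) (D' x h)\<close>
  becomes the product \<open>D' x h * D (f x) 1\<close>. The direction fed to \<open>D\<close> is
  then constant in \<open>x\<close>, and the induction hypothesis applies to
  \<open>D _ 1\<close>.\<close>

lemma Ck_on_compose_real:
  fixes g :: "real \<Rightarrow> real"
  assumes "Ck_on k UNIV g" "Ck_on k S f"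
  shows "Ck_on k S (\<lambda>x. g (f x))"
  using assms
proof (induction k arbitrary: g f)
  case 0
  then show ?case by (auto intro: continuous_on_compose2)
next
  case (Suc k)
  from Suc.prems(1) obtain D where D: "\<And>x. (g has_derivative D x) (at x)"
      "\<And>v. Ck_on k UNIV (\<lambda>x. D x v)"
    by auto
  from Suc.prems(2) obtain D' where D': "\<And>x. x \<in> S \<Longrightarrow> (f has_derivative D' x) (at x)"
      "\<And>v. Ck_on k S (\<lambda>x. D' x v)"
    by auto
  have f: "Ck_on k S f" using Suc.prems(2) by (rule Ck_on_SucD)
  have lin: "D t s = s * D t 1" for t s
    using linear_scale[OF has_derivative_linear[OF D(1)[of t]], of s 1] by simp
  have "Ck_on k S (\<lambda>x. D' x h * D (f x) 1)" for h
    by (intro Ck_on_mult D' Suc.IH[OF D(2) f])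
  then have "Ck_on k S (\<lambda>x. D (f x) (D' x h))" for h
    by (subst lin)
  moreover have "((\<lambda>x. g (f x)) has_derivative (\<lambda>h. D (f x) (D' x h))) (at x)" if "x \<in> S" for x
    using has_derivative_compose[OF D'(1)[OF that] D(1)] .
  ultimately show ?case
    unfolding Ck_on.simps by (intro exI[of _ "\<lambda>x h. D (f x) (D' x h)"]) auto
qed

text \<open>The derivative of the reciprocal is a product of \<open>D x h\<close> and two copies of
  the reciprocal itself, which is already known to be differentiable one order less.\<close>

lemma Ck_on_inverse:
  fixes f :: "'a::real_normed_vector \<Rightarrow> real"
  assumes "Ck_on k S f" "\<And>x. x \<in> S \<Longrightarrow> f x \<noteq> 0"
  shows "Ck_on k S (\<lambda>x. inverse (f x))"
  using assms(1)
proof (induction k)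
  case 0
  then show ?case using assms(2) by (auto intro: continuous_on_inverse)
next
  case (Suc k)
  then obtain D where D: "\<And>x. x \<in> S \<Longrightarrow> (f has_derivative D x) (at x)"
      "\<And>v. Ck_on k S (\<lambda>x. D x v)"
    by auto
  have inv: "Ck_on k S (\<lambda>x. inverse (f x))"
    using Suc by (auto intro: Ck_on_SucD simp del: Ck_on.simps)
  have "Ck_on k S (\<lambda>x. (- 1) * (inverse (f x) * D x h * inverse (f x)))" for h
    by (intro Ck_on_mult inv D(2) Ck_on_const)
  moreover have "((\<lambda>x. inverse (f x)) has_derivative
      (\<lambda>h. (- 1) * (inverse (f x) * D x h * inverse (f x)))) (at x)" if "x \<in> S" for x
    using Deriv.has_derivative_inverse[OF assms(2)[OF that] D(1)[OF that]] by simp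
  ultimately show ?case
    unfolding Ck_on.simps
    by (intro exI[of _ "\<lambda>x h. (- 1) * (inverse (f x) * D x h * inverse (f x))"]) auto
qed

section \<open>A smooth step function on the line\<close>

text \<open>The powers of \<open>1 / t\<close> make this family closed under differentiation, up to linear combinations.\<close>

definition flat_exp :: "nat \<Rightarrow> real \<Rightarrow> real"
  where "flat_exp n t = (if t > 0 then exp (- inverse t) * inverse t ^ n else 0)"

text \<open>From the right, the substitution of \<open>inverse t\<close> turns this into the decay
  of a power divided by the exponential at infinity; from the left the function is zero.\<close>

lemma flat_exp_tendsto_0: "(flat_exp n \<longlongrightarrow> 0) (at 0)"
proof -
  have "filterlim (\<lambda>t::real. inverse t) at_top (at_right 0)"
    by (rule filterlim_inverse_at_top_right)
  then have "((\<lambda>t::real. inverse t ^ n / exp (inverse t)) \<longlongrightarrow> 0) (at_right 0)"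
    using filterlim_compose[OF tendsto_power_div_exp_0] by blast
  moreover have "\<forall>\<^sub>F t::real in at_right 0. inverse t ^ n / exp (inverse t) = flat_exp n t"
    by (auto simp: eventually_at_filter flat_exp_def exp_minus field_simps)
  ultimately have r: "(flat_exp n \<longlongrightarrow> 0) (at_right 0)"
    by (rule Lim_transform_eventually)
  have "\<forall>\<^sub>F t::real in at_left 0. 0 = flat_exp n t"
    by (auto simp: eventually_at_filter flat_exp_def)
  then have "(flat_exp n \<longlongrightarrow> 0) (at_left 0)"
    using tendsto_cong[of "\<lambda>_. 0" "flat_exp n" "at_left 0" 0] by simp
  with r show ?thesis by (simp add: filterlim_at_split)
qed

lemma flat_exp_has_derivative:
  "(flat_exp n has_field_derivative flat_exp (n + 2) t - real n * flat_exp (n + 1) t) (at t)"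
proof -
  consider "t > 0" | "t < 0" | "t = 0" by linarith
  then show ?thesis
  proof cases
    case 1
    have "((\<lambda>t. exp (- inverse t) * inverse t ^ n) has_field_derivative
        flat_exp (n + 2) t - real n * flat_exp (n + 1) t) (at t)"
    proof (cases n)
      case 0
      then show ?thesis
        using 1 by (auto intro!: derivative_eq_intros simp: flat_exp_def power2_eq_square)
    next
      case (Suc m)
      have "((\<lambda>t. inverse t ^ Suc m) has_field_derivative
          real (Suc m) * (- (inverse t * inverse t) * inverse t ^ m)) (at t)"
        using DERIV_power[OF DERIV_inverse, of t "Suc m" UNIV] 1 by (simp add: mult_ac)
      moreover have "((\<lambda>t. exp (- inverse t)) has_field_derivative
          exp (- inverse t) * (inverse t * inverse t)) (at t)"
        using 1 by (auto intro!: derivative_eq_intros simp: power2_eq_square)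
      ultimately show ?thesis
        using DERIV_mult 1 Suc by (fastforce simp: flat_exp_def algebra_simps)
    qed
    then show ?thesis
      by (rule has_field_derivative_transform_within_open[of _ _ _ "{0<..}"]) (use 1 in \<open>auto simp: flat_exp_def\<close>)
  next
    case 2
    have "((\<lambda>_. 0) has_field_derivative 0) (at t)" by simp
    then have "(flat_exp n has_field_derivative 0) (at t)"
      by (rule has_field_derivative_transform_within_open[of _ _ _ "{..<0}"]) (use 2 in \<open>auto simp: flat_exp_def\<close>)
    then show ?thesis using 2 by (simp add: flat_exp_def)
  next
    case 3
    \<comment> \<open>Division by \<open>h\<close> raises the power of \<open>inverse h\<close> by
      one, so the difference quotient at 0 is again a member of the family and tends to 0.\<close>
    have "\<forall>\<^sub>F h in at 0. flat_exp (n + 1) h = (flat_exp n (0 + h) - flat_exp n 0) / h"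
      by (auto simp: eventually_at_filter flat_exp_def field_simps)
    then have "((\<lambda>h. (flat_exp n (0 + h) - flat_exp n 0) / h) \<longlongrightarrow> 0) (at 0)"
      by (rule Lim_transform_eventually[OF flat_exp_tendsto_0])
    then show ?thesis using 3 by (simp add: DERIV_def flat_exp_def)
  qed
qed

lemma Ck_on_flat_exp: "Ck_on k UNIV (flat_exp n)"
proof (induction k arbitrary: n)
  case 0
  then show ?case
    unfolding Ck_on.simps
    by (intro continuous_at_imp_continuous_on ballI DERIV_isCont[OF flat_exp_has_derivative])
next
  case (Suc k)
  have "Ck_on k UNIV (\<lambda>t. (flat_exp (n + 2) t - real n * flat_exp (n + 1) t) * h)" for h
    by (intro Ck_on_mult Ck_on_diff Ck_on_const Suc.IH)
  then show ?case
    using flat_exp_has_derivative[of n] unfolding Ck_on.simps has_field_derivative_def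
    by (intro exI[of _ "\<lambda>t h. (flat_exp (n + 2) t - real n * flat_exp (n + 1) t) * h"]) auto
qed

text \<open>The standard quotient of flat functions: \<open>2 - t\<close> and \<open>t - 1\<close>
  are never both nonpositive, so the denominator is positive. The second summand vanishes for t
  \<le> 1 and the numerator for t \<ge> 2.\<close>

lemma smooth_step_exists:
  obtains g :: "real \<Rightarrow> real" where
    "\<And>k. Ck_on k UNIV g" "\<And>t. t \<le> 1 \<Longrightarrow> g t = 1" "\<And>t. t \<ge> 2 \<Longrightarrow> g t = 0"
proof
  let ?h = "flat_exp 0"
  let ?g = "\<lambda>t. ?h (2 - t) * inverse (?h (2 - t) + ?h (t - 1))"
  have pos: "?h (2 - t) + ?h (t - 1) \<noteq> 0" for t
    by (cases "t < 2") (auto simp: flat_exp_def add_nonneg_eq_0_iff)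
  show "Ck_on k UNIV ?g" for k
    by (intro Ck_on_mult Ck_on_inverse Ck_on_add Ck_on_compose_real[OF Ck_on_flat_exp]
        Ck_on_diff Ck_on_const Ck_on_ident pos)
  show "?g t = 1" if "t \<le> 1" for t using that by (simp add: flat_exp_def)
  show "?g t = 0" if "t \<ge> 2" for t using that by (simp add: flat_exp_def)
qed


section \<open>Finite-dimensional inner product spaces\<close>

text \<open>Gram-Schmidt yields an orthogonal spanning set that may contain 0; removing 0 and
  normalising gives the basis. It is indexed by the numbers below the dimension so that it matches
  the indexing of frames by \<open>vb_rank\<close>, rank zero included.\<close>

lemma orthonormal_basis_exists:
  assumes "fin_dim TYPE('a::real_inner)"
  obtains d :: "nat \<Rightarrow> 'a::real_inner" and n where
    "n = dim (UNIV :: 'a::real_inner set)"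
    "\<And>i j. i < n \<Longrightarrow> j < n \<Longrightarrow> d i \<bullet> d j = (if i = j then 1 else 0)"
    "inj_on d {..<n}" "independent (d ` {..<n})" "span (d ` {..<n}) = UNIV"
    "\<And>x. x = (\<Sum>i<n. (x \<bullet> d i) *\<^sub>R d i)"
proof -
  obtain B :: "'a set" where "finite B" "span B = UNIV"
    using assms unfolding fin_dim_def by blast
  then obtain C :: "'a set" where C: "finite C" "span C = UNIV" "pairwise orthogonal C"
    using basis_orthogonal[of B] by auto
  define D where "D = (\<lambda>x. x /\<^sub>R norm x) ` (C - {0})"
  have fin: "finite D" and nz: "0 \<notin> D"
    using C(1) by (auto simp: D_def)
  have orth: "pairwise orthogonal D"
    using C(3) by (auto simp: D_def pairwise_def orthogonal_def)
  then have ind: "independent D"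
    using nz by (rule pairwise_orthogonal_independent)
  have unit: "x \<bullet> x = 1" if "x \<in> D" for x
  proof -
    from that obtain y where y: "y \<noteq> 0" "x = y /\<^sub>R norm y"
      unfolding D_def by (elim imageE DiffE) simp
    have "norm x = 1" unfolding y(2) using y(1) by simp
    then show ?thesis by (simp add: norm_eq_1)
  qed
  have "C \<subseteq> span D"
  proof
    fix x assume "x \<in> C"
    show "x \<in> span D"
    proof (cases "x = 0")
      case False
      then have "x /\<^sub>R norm x \<in> D" using \<open>x \<in> C\<close> by (auto simp: D_def)
      then have "norm x *\<^sub>R (x /\<^sub>R norm x) \<in> span D" by (intro span_scale span_base)
      then show ?thesis using False by simp
    qed (simp add: span_zero)
  qed
  then have "span C \<subseteq> span D" by (rule span_minimal[OF _ subspace_span])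
  then have sp: "span D = UNIV" using C(2) by auto
  define n where "n = card D"
  obtain d where d: "bij_betw d {..<n} D"
    using ex_bij_betw_nat_finite[OF fin] unfolding n_def atLeast0LessThan ..
  have im: "d ` {..<n} = D" and inj: "inj_on d {..<n}"
    using d by (auto simp: bij_betw_def)
  have dd: "d i \<bullet> d j = (if i = j then 1 else 0)" if "i < n" "j < n" for i j
  proof (cases "i = j")
    case True
    then show ?thesis using unit im that by auto
  next
    case False
    then have "d i \<noteq> d j" using inj that by (auto simp: inj_on_def)
    moreover have "d i \<in> D" "d j \<in> D" using im that by auto
    ultimately show ?thesis using orth False by (auto simp: pairwise_def orthogonal_def)
  qed
  have "x = (\<Sum>i<n. (x \<bullet> d i) *\<^sub>R d i)" for x
  proof -
    have "x \<in> range (\<lambda>u. \<Sum>v\<in>D. u v *\<^sub>R v)"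
      using sp span_finite[OF fin] by simp
    then obtain u where u: "x = (\<Sum>v\<in>D. u v *\<^sub>R v)" by blast
    then have x: "x = (\<Sum>i<n. u (d i) *\<^sub>R d i)"
      by (simp add: sum.reindex_bij_betw[OF d, symmetric])
    have "x \<bullet> d j = (\<Sum>i<n. if i = j then u (d j) else 0)" if "j < n" for j
      unfolding x inner_sum_left using that by (intro sum.cong) (auto simp: dd)
    then have "(\<Sum>i<n. (x \<bullet> d i) *\<^sub>R d i) = (\<Sum>i<n. u (d i) *\<^sub>R d i)"
      by (intro sum.cong) (auto simp: sum.delta)
    with x show ?thesis by simp
  qed
  moreover have "n = dim (UNIV :: 'a set)"
    using dim_eq_card[of D UNIV] ind sp by (simp add: n_def)
  ultimately show thesis using that[of n d] dd inj ind sp unfolding im by blast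
qed

text \<open>Heine-Borel for the model space. The set \<open>K m\<close> is the image of a coordinate
  box; it is compact because each step adds a compact segment to a compact set. By Cauchy-Schwarz
  the coordinates of a point of the ball are bounded by its norm, so the ball is a closed subset of
  \<open>K n\<close>.\<close>

lemma compact_cball_fin_dim:
  fixes x :: "'a::real_inner"
  assumes "fin_dim TYPE('a)"
  shows "compact (cball x r)"
proof -
  obtain d :: "nat \<Rightarrow> 'a" and n where
    dd: "\<And>i j. i < n \<Longrightarrow> j < n \<Longrightarrow> d i \<bullet> d j = (if i = j then 1 else 0)" and
    exp: "\<And>x. x = (\<Sum>i<n. (x \<bullet> d i) *\<^sub>R d i)"
    using orthonormal_basis_exists[OF assms] by metis
  define K where "K m = {\<Sum>i<m. c i *\<^sub>R d i | c. \<forall>i. \<bar>c i\<bar> \<le> norm x + r}" for m :: nat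
  have "compact (K m)" for m
  proof (induction m)
    case 0
    have "K 0 \<subseteq> {0}" by (auto simp: K_def)
    then show ?case by (meson finite.emptyI finite.insertI finite_imp_compact finite_subset)
  next
    case (Suc m)
    let ?I = "(\<lambda>c. c *\<^sub>R d m) ` {- (norm x + r)..norm x + r}"
    have "compact ?I"
      by (intro compact_continuous_image continuous_intros compact_Icc)
    then have "compact {y + z | y z. y \<in> K m \<and> z \<in> ?I}"
      by (rule compact_sums[OF Suc])
    moreover have "K (Suc m) = {y + z | y z. y \<in> K m \<and> z \<in> ?I}"
    proof (intro equalityI subsetI)
      fix y assume "y \<in> K (Suc m)"
      then obtain c where "y = (\<Sum>i<Suc m. c i *\<^sub>R d i)" "\<forall>i. \<bar>c i\<bar> \<le> norm x + r"
        unfolding K_def by blast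
      then show "y \<in> {y + z | y z. y \<in> K m \<and> z \<in> ?I}"
        unfolding K_def by (force simp: abs_le_iff)
    next
      fix y assume "y \<in> {y + z | y z. y \<in> K m \<and> z \<in> ?I}"
      then obtain c t where *: "y = (\<Sum>i<m. c i *\<^sub>R d i) + t *\<^sub>R d m"
          "\<forall>i. \<bar>c i\<bar> \<le> norm x + r" "\<bar>t\<bar> \<le> norm x + r"
        unfolding K_def by (auto simp: abs_le_iff)
      have "y = (\<Sum>i<Suc m. (c(m := t)) i *\<^sub>R d i)" using *(1) by simp
      moreover have "\<forall>i. \<bar>(c(m := t)) i\<bar> \<le> norm x + r" using * by simp
      ultimately show "y \<in> K (Suc m)" unfolding K_def by blast
    qed
    ultimately show ?case by simp
  qed
  moreover have "cball x r \<subseteq> K n"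
  proof
    fix y assume "y \<in> cball x r"
    then have y: "norm y \<le> norm x + r"
      using norm_triangle_ineq2[of y x] by (simp add: dist_norm norm_minus_commute)
    \<comment> \<open>The bound in \<open>K\<close> ranges over all indices, so the coordinates are
      padded with zeros from \<open>n\<close> on.\<close>
    define c where "c i = (if i < n then y \<bullet> d i else 0)" for i
    have "\<bar>c i\<bar> \<le> norm x + r" for i
    proof (cases "i < n")
      case True
      then have "norm (d i) = 1" using dd by (simp add: norm_eq_sqrt_inner)
      then have "\<bar>y \<bullet> d i\<bar> \<le> norm y" using Cauchy_Schwarz_ineq2[of y "d i"] by simp
      then show ?thesis using y True by (simp add: c_def)
    qed (use y norm_ge_zero[of y] in \<open>simp add: c_def del: norm_ge_zero\<close>)
    moreover have "y = (\<Sum>i<n. c i *\<^sub>R d i)"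
      using exp[of y] by (simp add: c_def)
    ultimately show "y \<in> K n" unfolding K_def by blast
  qed
  ultimately show ?thesis
    using closed_Int_compact[OF closed_cball, of "K n" x r] by (simp add: Int_absorb2)
qed

section \<open>Smooth maps on manifolds\<close>

lemma smooth_map_on_iff:
  "smooth_map_on A W f \<longleftrightarrow>
    (\<forall>c\<in>A. \<forall>k. Ck_on k (snd c ` (fst c \<inter> W)) (\<lambda>x. f (inv_into (fst c) (snd c) x)))"
  by (auto simp: smooth_map_on_def smooth_on_def comp_def split_beta)

lemma smooth_map_on_subset:
  assumes "smooth_map_on A W f" "V \<subseteq> W"
  shows "smooth_map_on A V f"
  unfolding smooth_map_on_iff
proof (intro ballI allI)
  fix c k assume "c \<in> A"
  then have "Ck_on k (snd c ` (fst c \<inter> W)) (\<lambda>x. f (inv_into (fst c) (snd c) x))"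
    using assms(1) by (simp add: smooth_map_on_iff)
  then show "Ck_on k (snd c ` (fst c \<inter> V)) (\<lambda>x. f (inv_into (fst c) (snd c) x))"
    by (rule Ck_on_subset) (use assms(2) in blast)
qed

lemma smooth_manifoldD:
  fixes A :: "('m::{t2_space, second_countable_topology}, 'b::real_inner) atlas"
  assumes "smooth_manifold A"
  shows "fin_dim TYPE('b)" "\<exists>U \<phi>. (U, \<phi>) \<in> A \<and> p \<in> U"
    "\<And>U \<phi>. (U, \<phi>) \<in> A \<Longrightarrow> open U"
    "\<And>U \<phi>. (U, \<phi>) \<in> A \<Longrightarrow> open (\<phi> ` U)"
    "\<And>U \<phi>. (U, \<phi>) \<in> A \<Longrightarrow> homeomorphism U (\<phi> ` U) \<phi> (inv_into U \<phi>)"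
    "\<And>U \<phi> V \<psi>. (U, \<phi>) \<in> A \<Longrightarrow> (V, \<psi>) \<in> A \<Longrightarrow>
      smooth_on (\<phi> ` (U \<inter> V)) (\<psi> \<circ> inv_into U \<phi>)"
proof -
  have "p \<in> (\<Union>(U, \<phi>)\<in>A. U)" using assms unfolding smooth_manifold_def by simp
  then show "\<exists>U \<phi>. (U, \<phi>) \<in> A \<and> p \<in> U" by auto
next
  fix U \<phi> V \<psi> assume U: "(U, \<phi>) \<in> A" and V: "(V, \<psi>) \<in> A"
  have "\<forall>(U, \<phi>)\<in>A. \<forall>(V, \<psi>)\<in>A. smooth_on (\<phi> ` (U \<inter> V)) (\<psi> \<circ> inv_into U \<phi>)"
    using assms unfolding smooth_manifold_def by (elim conjE)
  from bspec[OF this U]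
  have "\<forall>(V, \<psi>)\<in>A. smooth_on (\<phi> ` (U \<inter> V)) (\<psi> \<circ> inv_into U \<phi>)"
    by (simp only: prod.case)
  from bspec[OF this V] show "smooth_on (\<phi> ` (U \<inter> V)) (\<psi> \<circ> inv_into U \<phi>)"
    by (simp only: prod.case)
qed (use assms[unfolded smooth_manifold_def] in auto)

lemma chart_image_open:
  assumes "smooth_manifold A" "(U, \<phi>) \<in> A" "open W"
  shows "open (\<phi> ` (U \<inter> W))"
proof -
  have "openin (top_of_set (\<phi> ` U)) (\<phi> ` (U \<inter> W))"
    by (rule homeomorphism_imp_open_map[OF smooth_manifoldD(5)[OF assms(1,2)]
          openin_open_Int[OF assms(3)]])
  then show ?thesis
    using smooth_manifoldD(4)[OF assms(1,2)] by (rule openin_open_trans)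
qed

lemma chart_inv_into:
  assumes "smooth_manifold A" "(U, \<phi>) \<in> A" "q \<in> U"
  shows "inv_into U \<phi> (\<phi> q) = q"
proof -
  have "homeomorphism U (\<phi> ` U) \<phi> (inv_into U \<phi>)"
    using smooth_manifoldD(5)[OF assms(1,2)] .
  then show ?thesis using assms(3) by (simp add: homeomorphism_def)
qed

lemma smooth_map_on_cong:
  assumes A: "smooth_manifold A" and W: "open W" and eq: "\<And>q. q \<in> W \<Longrightarrow> f q = g q"
    and f: "smooth_map_on A W f"
  shows "smooth_map_on A W g"
  unfolding smooth_map_on_def smooth_on_def
proof clarify
  fix U \<phi> k assume U: "(U, \<phi>) \<in> A"
  have "Ck_on k (\<phi> ` (U \<inter> W)) (f \<circ> inv_into U \<phi>)"
    using f U unfolding smooth_map_on_def smooth_on_def by auto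
  then show "Ck_on k (\<phi> ` (U \<inter> W)) (g \<circ> inv_into U \<phi>)"
    by (rule Ck_on_cong[OF chart_image_open[OF A U W], rotated])
      (auto simp: chart_inv_into[OF A U] eq)
qed

lemma smooth_map_on_UN:
  assumes A: "smooth_manifold A"
    and W: "\<And>i. i \<in> I \<Longrightarrow> open (W i)" "\<And>i. i \<in> I \<Longrightarrow> smooth_map_on A (W i) f"
  shows "smooth_map_on A (\<Union>i\<in>I. W i) f"
  unfolding smooth_map_on_def smooth_on_def
proof clarify
  fix U \<phi> k assume U: "(U, \<phi>) \<in> A"
  have "Ck_on k (\<Union>i\<in>I. \<phi> ` (U \<inter> W i)) (f \<circ> inv_into U \<phi>)"
  proof (rule Ck_on_UN)
    fix i assume i: "i \<in> I"
    show "open (\<phi> ` (U \<inter> W i))" by (rule chart_image_open[OF A U W(1)[OF i]])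
    show "Ck_on k (\<phi> ` (U \<inter> W i)) (f \<circ> inv_into U \<phi>)"
      using W(2)[OF i] U unfolding smooth_map_on_def smooth_on_def by auto
  qed
  moreover have "\<phi> ` (U \<inter> (\<Union>i\<in>I. W i)) = (\<Union>i\<in>I. \<phi> ` (U \<inter> W i))" by blast
  ultimately show "Ck_on k (\<phi> ` (U \<inter> (\<Union>i\<in>I. W i))) (f \<circ> inv_into U \<phi>)"
    by (simp only:)
qed

lemma smooth_map_on_Un:
  assumes "smooth_manifold A" "open V" "open W" "smooth_map_on A V f" "smooth_map_on A W f"
  shows "smooth_map_on A (V \<union> W) f"
proof -
  have "smooth_map_on A (\<Union>S\<in>{V, W}. S) f"
    by (rule smooth_map_on_UN[OF assms(1)]) (use assms in auto)
  then show ?thesis by simp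
qed

lemma smooth_map_on_const: "smooth_map_on A W (\<lambda>_. c)"
  unfolding smooth_map_on_iff by (simp add: Ck_on_const)

lemma smooth_map_on_add:
  "smooth_map_on A W f \<Longrightarrow> smooth_map_on A W g \<Longrightarrow> smooth_map_on A W (\<lambda>q. f q + g q)"
  unfolding smooth_map_on_iff by (simp add: Ck_on_add)

lemma smooth_map_on_diff:
  "smooth_map_on A W f \<Longrightarrow> smooth_map_on A W g \<Longrightarrow> smooth_map_on A W (\<lambda>q. f q - g q)"
  unfolding smooth_map_on_iff by (simp add: Ck_on_diff)

lemma smooth_map_on_scaleR:
  "smooth_map_on A W f \<Longrightarrow> smooth_map_on A W g \<Longrightarrow> smooth_map_on A W (\<lambda>q. f q *\<^sub>R g q)"
  unfolding smooth_map_on_iff by (simp add: Ck_on_scaleR)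

lemma smooth_map_on_inner:
  "smooth_map_on A W f \<Longrightarrow> smooth_map_on A W g \<Longrightarrow> smooth_map_on A W (\<lambda>q. f q \<bullet> g q)"
  unfolding smooth_map_on_iff by (simp add: Ck_on_inner)

lemma smooth_map_on_compose_real:
  fixes g :: "real \<Rightarrow> real"
  shows "(\<And>k. Ck_on k UNIV g) \<Longrightarrow> smooth_map_on A W f \<Longrightarrow> smooth_map_on A W (\<lambda>q. g (f q))"
  unfolding smooth_map_on_iff by (intro ballI allI, rule Ck_on_compose_real) simp_all

lemma smooth_map_on_sum:
  "(\<And>i. i \<in> I \<Longrightarrow> smooth_map_on A W (f i)) \<Longrightarrow> smooth_map_on A W (\<lambda>q. \<Sum>i\<in>I. f i q)"
  by (induction I rule: infinite_finite_induct)
    (simp_all add: smooth_map_on_const smooth_map_on_add)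

text \<open>Read in any other chart, a coordinate map is a transition map.\<close>

lemma smooth_map_on_chart:
  assumes "smooth_manifold A" "(U, \<phi>) \<in> A"
  shows "smooth_map_on A U \<phi>"
  unfolding smooth_map_on_def using smooth_manifoldD(6)[OF assms(1) _ assms(2)] by auto

text \<open>The step function is composed with a scaled squared distance in a chart and extended by
  zero. The closed set \<open>K\<close> is part of the conclusion because products with the bump are
  later extended by zero too, and this needs an open set \<open>- K\<close> that together with
  \<open>W\<close> covers everything.\<close>

lemma bump_function_exists:
  fixes A :: "('m::{t2_space, second_countable_topology}, 'b::real_inner) atlas"
  assumes A: "smooth_manifold A" and W: "open W" "p \<in> W"
  obtains \<beta> N K where "\<beta> \<in> Cinf A" "open N" "p \<in> N" "closed K" "N \<subseteq> K" "K \<subseteq> W"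
    "\<And>q. q \<in> N \<Longrightarrow> \<beta> q = 1" "\<And>q. q \<notin> K \<Longrightarrow> \<beta> q = 0"
proof -
  obtain U \<phi> where U: "(U, \<phi>) \<in> A" "p \<in> U"
    using smooth_manifoldD(2)[OF A] by blast
  have homeo: "homeomorphism U (\<phi> ` U) \<phi> (inv_into U \<phi>)" and oU: "open U"
    and fd: "fin_dim TYPE('b)"
    by (rule smooth_manifoldD[OF A] smooth_manifoldD(3,5)[OF A U(1)])+
  have "\<phi> p \<in> \<phi> ` (U \<inter> W)" using U W by simp
  with chart_image_open[OF A U(1) W(1)]
  obtain r where r: "r > 0" "cball (\<phi> p) r \<subseteq> \<phi> ` (U \<inter> W)"
    unfolding open_contains_cball by metis
  \<comment> \<open>The squared norm, unlike the norm, is smooth at \<open>p\<close>. The factor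
    sends the sphere of radius \<open>r\<close> to the threshold 2 of \<open>g\<close>, while on the
    ball of radius \<open>r / 2\<close> the value is at most 1/2, below the threshold 1.\<close>
  define \<theta> where "\<theta> q = 2 * ((\<phi> q - \<phi> p) \<bullet> (\<phi> q - \<phi> p)) / r\<^sup>2" for q
  have \<theta>: "\<theta> q = 2 * (norm (\<phi> q - \<phi> p) / r)\<^sup>2" for q
    by (simp add: \<theta>_def power2_norm_eq_inner power_divide)
  obtain g :: "real \<Rightarrow> real" where
    g: "\<And>k. Ck_on k UNIV g" "\<And>t. t \<le> 1 \<Longrightarrow> g t = 1" "\<And>t. t \<ge> 2 \<Longrightarrow> g t = 0"
    by (metis smooth_step_exists)
  define K where "K = inv_into U \<phi> ` cball (\<phi> p) r"
  define N where "N = U \<inter> \<phi> -` ball (\<phi> p) (r / 2)"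
  define \<beta> where "\<beta> q = (if q \<in> U then g (\<theta> q) else 0)" for q
  have K_iff: "q \<in> K \<longleftrightarrow> q \<in> U \<and> dist (\<phi> p) (\<phi> q) \<le> r" for q
  proof
    assume "q \<in> K"
    then obtain y where y: "y \<in> cball (\<phi> p) r" "q = inv_into U \<phi> y" unfolding K_def by blast
    then have "y \<in> \<phi> ` U" using r by blast
    then have "q \<in> U" "\<phi> q = y" using y by (auto simp: inv_into_into f_inv_into_f)
    then show "q \<in> U \<and> dist (\<phi> p) (\<phi> q) \<le> r" using y by simp
  next
    assume q: "q \<in> U \<and> dist (\<phi> p) (\<phi> q) \<le> r"
    then have "q = inv_into U \<phi> (\<phi> q)" using chart_inv_into[OF A U(1)] by simp
    then show "q \<in> K" using q unfolding K_def by (metis imageI mem_cball)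
  qed
  \<comment> \<open>Being closed inside the chart domain does not suffice: the extension by zero is
    smooth across the rim only if \<open>K\<close> is closed in the manifold. Compactness and the
    Hausdorff property give this.\<close>
  have "compact K"
    unfolding K_def
  proof (rule compact_continuous_image[OF _ compact_cball_fin_dim[OF fd]])
    show "continuous_on (cball (\<phi> p) r) (inv_into U \<phi>)"
      using homeo r by (auto simp: homeomorphism_def intro: continuous_on_subset)
  qed
  then have K: "closed K" by (rule compact_imp_closed)
  have N: "open N"
    using homeo oU unfolding N_def
    by (intro continuous_open_preimage) (auto simp: homeomorphism_def)
  have KW: "K \<subseteq> W"
  proof
    fix q assume "q \<in> K"
    then have q: "q \<in> U" "\<phi> q \<in> cball (\<phi> p) r" by (auto simp: K_iff)
    then obtain q' where q': "q' \<in> U" "q' \<in> W" "\<phi> q = \<phi> q'" using r by blast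
    then have "q = q'" using chart_inv_into[OF A U(1)] q by metis
    then show "q \<in> W" using q' by simp
  qed
  have out: "\<beta> q = 0" if "q \<notin> K" for q
  proof (cases "q \<in> U")
    case True
    then have "norm (\<phi> q - \<phi> p) / r \<ge> 1"
      using that r by (simp add: K_iff dist_norm norm_minus_commute)
    then have "\<theta> q \<ge> 2" by (simp add: \<theta> one_le_power)
    then show ?thesis by (simp add: \<beta>_def g)
  qed (simp add: \<beta>_def)
  have diff: "smooth_map_on A U (\<lambda>q. \<phi> q - \<phi> p)"
    by (rule smooth_map_on_diff[OF smooth_map_on_chart[OF A U(1)] smooth_map_on_const])
  have "smooth_map_on A U (\<lambda>q. g ((2 / r\<^sup>2) *\<^sub>R ((\<phi> q - \<phi> p) \<bullet> (\<phi> q - \<phi> p))))"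
    by (rule smooth_map_on_compose_real[OF g(1)])
      (rule smooth_map_on_scaleR[OF smooth_map_on_const smooth_map_on_inner[OF diff diff]])
  then have "smooth_map_on A U \<beta>"
    by (rule smooth_map_on_cong[OF A oU, rotated]) (simp add: \<beta>_def \<theta>_def)
  moreover have "smooth_map_on A (- K) \<beta>"
    by (rule smooth_map_on_cong[OF A _ _ smooth_map_on_const[of A "- K" 0]])
      (use K out in auto)
  ultimately have "smooth_map_on A (U \<union> - K) \<beta>"
    using A oU K by (intro smooth_map_on_Un) auto
  moreover have "U \<union> - K = UNIV" using K_iff by blast
  ultimately have "\<beta> \<in> Cinf A" by (simp add: Cinf_def)
  moreover have "\<beta> q = 1" if "q \<in> N" for q
  proof -
    have q: "q \<in> U" "norm (\<phi> q - \<phi> p) / r \<le> 1 / 2"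
      using that r by (auto simp: N_def dist_norm norm_minus_commute)
    have "(norm (\<phi> q - \<phi> p) / r)\<^sup>2 \<le> (1 / 2)\<^sup>2"
      using q r by (intro power_mono) auto
    moreover have "(1 / 2)\<^sup>2 = (1 / 4 :: real)" by (simp add: power2_eq_square)
    ultimately have "\<theta> q \<le> 1" unfolding \<theta> by linarith
    then show ?thesis using q by (simp add: \<beta>_def g)
  qed
  moreover have "p \<in> N" using U r by (simp add: N_def)
  moreover have "N \<subseteq> K" using r by (auto simp: N_def K_iff)
  ultimately show thesis using that[of \<beta> N K] N K KW out by simp
qed

section \<open>Vector bundles and their duals\<close>

lemma linear_over_0:
  assumes "subspace S" "linear_over S h"
  shows "h 0 = 0"
  using assms unfolding linear_over_def by (metis scaleR_zero_left subspace_0)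

lemma linear_over_sum:
  assumes "subspace S" "linear_over S h" "\<And>i. i \<in> I \<Longrightarrow> x i \<in> S"
  shows "h (\<Sum>i\<in>I. c i *\<^sub>R x i) = (\<Sum>i\<in>I. c i *\<^sub>R h (x i))"
  using assms(3)
proof (induction I rule: infinite_finite_induct)
  case (insert i I)
  have "(\<Sum>i\<in>I. c i *\<^sub>R x i) \<in> S" "c i *\<^sub>R x i \<in> S" "x i \<in> S"
    using insert.prems assms(1) by (simp_all add: subspace_sum subspace_scale)
  then show ?case
    using insert assms(2) by (simp add: linear_over_def)
qed (simp_all add: linear_over_0[OF assms(1,2)])

text \<open>While \<open>h\<close> is linear only on \<open>S\<close>, its inverse is defined on the
  whole model fibre, hence linear in the ordinary sense and open to the standard results on spans
  and independence.\<close>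

lemma linear_inv_into:
  assumes S: "subspace S" and h: "linear_over S h" and bij: "bij_betw h S UNIV"
  shows "linear (inv_into S h)"
proof (rule linearI)
  have inv: "inv_into S h y \<in> S" "h (inv_into S h y) = y" for y
    using bij by (simp_all add: bij_betw_def inv_into_into f_inv_into_f)
  have inj: "inv_into S h (h x) = x" if "x \<in> S" for x
    using bij that by (simp add: bij_betw_def)
  show "inv_into S h (y + z) = inv_into S h y + inv_into S h z" for y z
    using inj[of "inv_into S h y + inv_into S h z"] h inv
    by (simp add: linear_over_def subspace_add[OF S])
  show "inv_into S h (c *\<^sub>R y) = c *\<^sub>R inv_into S h y" for c y
    using inj[of "c *\<^sub>R inv_into S h y"] h inv
    by (simp add: linear_over_def subspace_scale[OF S])
qed

section \<open>Riesz representation on a single fibre\<close>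

definition dual_space :: "'v::real_vector set \<Rightarrow> ('v \<Rightarrow> real) set"
  where "dual_space S = {\<alpha>. linear_over S \<alpha> \<and> (\<forall>x. x \<notin> S \<longrightarrow> \<alpha> x = 0)}"

text \<open>This is the trivialisation of \<open>dual_bundle\<close> at one point, with
  \<open>S\<close> the fibre of \<open>E\<close> and \<open>h\<close> its trivialisation
  there.\<close>

definition riesz_vector :: "'v::real_vector set \<Rightarrow> ('v \<Rightarrow> 'f::real_inner) \<Rightarrow> ('v \<Rightarrow> real) \<Rightarrow> 'f"
  where "riesz_vector S h \<alpha> = (THE c. \<forall>x\<in>S. \<alpha> x = c \<bullet> h x)"

lemma subspace_dual_space: "subspace S \<Longrightarrow> subspace (dual_space S)"
  by (auto simp: subspace_def dual_space_def linear_over_def scaleR_fun_def algebra_simps)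

lemma dual_bundle_simps:
  "fib (dual_bundle E) p = dual_space (fib E p)"
  "trv (dual_bundle E) = (\<lambda>(U, \<tau>). (U, \<lambda>p. riesz_vector (fib E p) (\<tau> p))) ` trv E"
  by (simp_all add: dual_bundle_def dual_space_def riesz_vector_def[abs_def])

text \<open>Since \<open>h\<close> is onto, a representing vector has prescribed inner products with
  all vectors and is therefore unique; exhibiting one representative settles the definite
  description.\<close>

lemma riesz_vector_eqI:
  assumes "bij_betw h S UNIV" "\<And>x. x \<in> S \<Longrightarrow> \<alpha> x = c \<bullet> h x"
  shows "riesz_vector S h \<alpha> = c"
  unfolding riesz_vector_def
proof (rule the_equality)
  fix c' assume c': "\<forall>x\<in>S. \<alpha> x = c' \<bullet> h x"
  have "c' \<bullet> y = c \<bullet> y" for y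
  proof -
    obtain x where "x \<in> S" "y = h x"
      using assms(1) by (metis UNIV_I bij_betw_def imageE)
    then show ?thesis using c' assms(2) by simp
  qed
  then show "c' = c" using vector_eq_rdot by blast
qed (use assms in simp)

text \<open>Existence of the representative: in an orthonormal basis its coordinates are the values
  of the functional on the vectors that \<open>h\<close> sends to the basis.\<close>

lemma riesz_vector_inner:
  fixes h :: "'v::real_vector \<Rightarrow> 'f::real_inner"
  assumes S: "subspace S" and h: "linear_over S h" and bij: "bij_betw h S UNIV"
    and fd: "fin_dim TYPE('f)" and \<alpha>: "\<alpha> \<in> dual_space S" and x: "x \<in> S"
  shows "\<alpha> x = riesz_vector S h \<alpha> \<bullet> h x"
proof -
  obtain d :: "nat \<Rightarrow> 'f" and n where exp: "\<And>y. y = (\<Sum>i<n. (y \<bullet> d i) *\<^sub>R d i)"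
    using orthonormal_basis_exists[OF fd] by metis
  let ?g = "inv_into S h"
  have lin: "linear ?g" using linear_inv_into[OF S h bij] .
  have g: "?g y \<in> S" for y using bij by (simp add: bij_betw_def inv_into_into)
  define c where "c = (\<Sum>i<n. \<alpha> (?g (d i)) *\<^sub>R d i)"
  have "\<alpha> z = c \<bullet> h z" if "z \<in> S" for z
  proof -
    have "z = ?g (h z)" using bij that by (simp add: bij_betw_def)
    also have "\<dots> = ?g (\<Sum>i<n. (h z \<bullet> d i) *\<^sub>R d i)"
      using exp[of "h z"] by simp
    also have "\<dots> = (\<Sum>i<n. (h z \<bullet> d i) *\<^sub>R ?g (d i))"
      by (simp add: linear_sum[OF lin] linear_scale[OF lin])
    finally have "\<alpha> z = \<alpha> (\<Sum>i<n. (h z \<bullet> d i) *\<^sub>R ?g (d i))" by simp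
    also have "\<dots> = (\<Sum>i<n. (h z \<bullet> d i) *\<^sub>R \<alpha> (?g (d i)))"
      using \<alpha> g by (intro linear_over_sum[OF S]) (auto simp: dual_space_def)
    also have "\<dots> = c \<bullet> h z"
      by (simp add: c_def inner_sum_left inner_commute[of "h z"] mult.commute)
    finally show ?thesis .
  qed
  then show ?thesis using x riesz_vector_eqI[OF bij, of \<alpha> c] by simp
qed

text \<open>The inverse is written down explicitly: it sends \<open>c\<close> to the functional
  \<open>c \<bullet> h x\<close>, cut off to zero outside \<open>S\<close>. This formula is what
  later gives both the dual transition maps and the duality of frame and coframe.\<close>

lemma
  fixes h :: "'v::real_vector \<Rightarrow> 'f::real_inner"
  assumes S: "subspace S" and h: "linear_over S h" and bij: "bij_betw h S UNIV"
    and fd: "fin_dim TYPE('f)"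
  shows linear_over_riesz_vector: "linear_over (dual_space S) (riesz_vector S h)"
    and bij_betw_riesz_vector: "bij_betw (riesz_vector S h) (dual_space S) UNIV"
    and inv_into_riesz_vector:
      "inv_into (dual_space S) (riesz_vector S h) c = (\<lambda>x. if x \<in> S then c \<bullet> h x else 0)"
proof -
  note inner = riesz_vector_inner[OF S h bij fd]
  define F where "F c = (\<lambda>x. if x \<in> S then c \<bullet> h x else 0)" for c
  have F: "F c \<in> dual_space S" for c
    using h S by (auto simp: F_def dual_space_def linear_over_def inner_add_right
        subspace_add subspace_scale)
  have riesz_F: "riesz_vector S h (F c) = c" for c
    by (rule riesz_vector_eqI[OF bij]) (simp add: F_def)
  have F_riesz: "F (riesz_vector S h \<alpha>) = \<alpha>" if "\<alpha> \<in> dual_space S" for \<alpha>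
    using inner[OF that] that by (auto simp: F_def dual_space_def)
  show *: "bij_betw (riesz_vector S h) (dual_space S) UNIV"
    by (rule bij_betw_byWitness[where f' = F]) (auto simp: F riesz_F F_riesz)
  show "inv_into (dual_space S) (riesz_vector S h) c = (\<lambda>x. if x \<in> S then c \<bullet> h x else 0)"
    using inv_into_f_eq[of "riesz_vector S h" "dual_space S" "F c" c] * F riesz_F
    by (simp add: bij_betw_def F_def)
  show "linear_over (dual_space S) (riesz_vector S h)"
    unfolding linear_over_def
  proof (intro conjI ballI allI)
    fix \<alpha> \<beta> assume *: "\<alpha> \<in> dual_space S" "\<beta> \<in> dual_space S"
    show "riesz_vector S h (\<alpha> + \<beta>) = riesz_vector S h \<alpha> + riesz_vector S h \<beta>"
      by (rule riesz_vector_eqI[OF bij]) (simp add: inner[OF *(1)] inner[OF *(2)] inner_add_left)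
  next
    fix c \<alpha> assume *: "\<alpha> \<in> dual_space S"
    show "riesz_vector S h (c *\<^sub>R \<alpha>) = c *\<^sub>R riesz_vector S h \<alpha>"
      by (rule riesz_vector_eqI[OF bij]) (simp add: inner[OF *] scaleR_fun_def)
  qed
qed

section \<open>Vector bundles and the dual bundle\<close>

lemma vector_bundleD:
  fixes E :: "('m::topological_space, 'v::real_vector, 'f::real_inner) vbundle"
  assumes "vector_bundle A E"
  shows "fin_dim TYPE('f)" "\<And>p. subspace (fib E p)" "\<And>p. \<exists>U \<tau>. (U, \<tau>) \<in> trv E \<and> p \<in> U"
    "\<And>U \<tau>. (U, \<tau>) \<in> trv E \<Longrightarrow> open U"
    "\<And>U \<tau> p. (U, \<tau>) \<in> trv E \<Longrightarrow> p \<in> U \<Longrightarrow> linear_over (fib E p) (\<tau> p)"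
    "\<And>U \<tau> p. (U, \<tau>) \<in> trv E \<Longrightarrow> p \<in> U \<Longrightarrow> bij_betw (\<tau> p) (fib E p) UNIV"
    "\<And>U \<tau> V \<sigma> c. (U, \<tau>) \<in> trv E \<Longrightarrow> (V, \<sigma>) \<in> trv E \<Longrightarrow>
      smooth_map_on A (U \<inter> V) (\<lambda>p. \<sigma> p (inv_into (fib E p) (\<tau> p) c))"
proof -
  fix p
  have "p \<in> (\<Union>(U, \<tau>)\<in>trv E. U)" using assms unfolding vector_bundle_def by simp
  then show "\<exists>U \<tau>. (U, \<tau>) \<in> trv E \<and> p \<in> U" by auto
next
  fix U \<tau> V \<sigma> c assume U: "(U, \<tau>) \<in> trv E" and V: "(V, \<sigma>) \<in> trv E"
  have "\<forall>(U, \<tau>)\<in>trv E. \<forall>(V, \<sigma>)\<in>trv E. \<forall>c.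
      smooth_map_on A (U \<inter> V) (\<lambda>p. \<sigma> p (inv_into (fib E p) (\<tau> p) c))"
    using assms unfolding vector_bundle_def by (elim conjE)
  from bspec[OF this U] have "\<forall>(V, \<sigma>)\<in>trv E. \<forall>c.
      smooth_map_on A (U \<inter> V) (\<lambda>p. \<sigma> p (inv_into (fib E p) (\<tau> p) c))"
    by (simp only: prod.case)
  from bspec[OF this V]
  show "smooth_map_on A (U \<inter> V) (\<lambda>p. \<sigma> p (inv_into (fib E p) (\<tau> p) c))"
    by simp
qed (use assms[unfolded vector_bundle_def] in auto)

text \<open>A transition map of the dual is the transpose of the reverse transition map of
  \<open>E\<close>. Its coordinate along \<open>d i\<close> is the inner product of \<open>c\<close>
  with the reverse transition applied to \<open>d i\<close>, hence smooth, and finitely many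
  coordinates suffice.\<close>

lemma vector_bundle_dual:
  fixes E :: "('m::{t2_space, second_countable_topology}, 'v::real_vector, 'f::real_inner) vbundle"
  assumes A: "smooth_manifold A" and E: "vector_bundle A E"
  shows "vector_bundle A (dual_bundle E)"
proof -
  note D = vector_bundleD[OF E]
  obtain d :: "nat \<Rightarrow> 'f" and n where exp: "\<And>y. y = (\<Sum>i<n. (y \<bullet> d i) *\<^sub>R d i)"
    using orthonormal_basis_exists[OF D(1)] by metis
  have smooth: "smooth_map_on A (U \<inter> V) (\<lambda>p. riesz_vector (fib E p) (\<sigma> p)
      (inv_into (dual_space (fib E p)) (riesz_vector (fib E p) (\<tau> p)) c))"
    if U: "(U, \<tau>) \<in> trv E" and V: "(V, \<sigma>) \<in> trv E" for U V \<tau> \<sigma> c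
  proof (rule smooth_map_on_cong[OF A])
    show "open (U \<inter> V)" using D(4) U V by blast
    have "smooth_map_on A (U \<inter> V) (\<lambda>p. \<tau> p (inv_into (fib E p) (\<sigma> p) (d i)))" for i
      using D(7)[OF V U] by (simp add: Int_commute)
    then show "smooth_map_on A (U \<inter> V)
        (\<lambda>p. \<Sum>i<n. (c \<bullet> \<tau> p (inv_into (fib E p) (\<sigma> p) (d i))) *\<^sub>R d i)"
      by (rule smooth_map_on_sum[OF smooth_map_on_scaleR[OF smooth_map_on_inner[OF
              smooth_map_on_const] smooth_map_on_const]])
    fix p assume p: "p \<in> U \<inter> V"
    let ?S = "fib E p"
    let ?\<alpha> = "inv_into (dual_space ?S) (riesz_vector ?S (\<tau> p)) c"
    have \<tau>: "linear_over ?S (\<tau> p)" "bij_betw (\<tau> p) ?S UNIV"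
      and \<sigma>: "linear_over ?S (\<sigma> p)" "bij_betw (\<sigma> p) ?S UNIV"
      using D(5,6) U V p by blast+
    have \<alpha>: "?\<alpha> = (\<lambda>x. if x \<in> ?S then c \<bullet> \<tau> p x else 0)"
      by (rule inv_into_riesz_vector[OF D(2) \<tau> D(1)])
    have \<alpha>_dual: "?\<alpha> \<in> dual_space ?S"
      using bij_betw_riesz_vector[OF D(2) \<tau> D(1)] by (simp add: bij_betw_def inv_into_into)
    have "riesz_vector ?S (\<sigma> p) ?\<alpha> \<bullet> d i = c \<bullet> \<tau> p (inv_into ?S (\<sigma> p) (d i))" for i
    proof -
      have *: "inv_into ?S (\<sigma> p) (d i) \<in> ?S" "\<sigma> p (inv_into ?S (\<sigma> p) (d i)) = d i"
        using \<sigma>(2) by (simp_all add: bij_betw_def inv_into_into f_inv_into_f)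
      show ?thesis
        using riesz_vector_inner[OF D(2) \<sigma> D(1) \<alpha>_dual *(1)] * by (simp add: \<alpha>)
    qed
    then show "(\<Sum>i<n. (c \<bullet> \<tau> p (inv_into ?S (\<sigma> p) (d i))) *\<^sub>R d i) =
        riesz_vector ?S (\<sigma> p) ?\<alpha>"
      using exp[of "riesz_vector ?S (\<sigma> p) ?\<alpha>"] by simp
  qed
  have "(\<Union>(U, \<tau>)\<in>trv (dual_bundle E). U) = UNIV"
    using D(3) by (fastforce simp: dual_bundle_simps)
  then show ?thesis
    unfolding vector_bundle_def
    using D(1,2,4,5,6) smooth
    by (auto simp: dual_bundle_simps subspace_dual_space linear_over_riesz_vector
        bij_betw_riesz_vector)
qed

section \<open>Sections\<close>

lemma sections_fib: "u \<in> sections A E \<Longrightarrow> u p \<in> fib E p"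
  by (simp add: sections_def local_section_def)

lemma sections_smooth:
  "u \<in> sections A E \<Longrightarrow> (U, \<tau>) \<in> trv E \<Longrightarrow> smooth_map_on A U (\<lambda>p. \<tau> p (u p))"
  by (auto simp: sections_def local_section_def)

lemma sectionsI:
  assumes "\<And>p. u p \<in> fib E p" "\<And>U \<tau>. (U, \<tau>) \<in> trv E \<Longrightarrow> smooth_map_on A U (\<lambda>p. \<tau> p (u p))"
  shows "u \<in> sections A E"
  using assms by (auto simp: sections_def local_section_def)

lemma Cinf_smooth: "f \<in> Cinf A \<Longrightarrow> smooth_map_on A W f"
  by (auto simp: Cinf_def intro: smooth_map_on_subset)

lemma sum_fun_apply: "(\<Sum>i\<in>I. f i) x = (\<Sum>i\<in>I. f i x)"
  by (induction I rule: infinite_finite_induct) simp_all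

context
  fixes A :: "('m::{t2_space, second_countable_topology}, 'b::real_inner) atlas"
    and E :: "('m, 'v::real_vector, 'f::real_inner) vbundle"
  assumes A: "smooth_manifold A" and E: "vector_bundle A E"
begin

lemma sections_smult:
  assumes "f \<in> Cinf A" "u \<in> sections A E"
  shows "f \<odot> u \<in> sections A E"
proof (rule sectionsI)
  show "(f \<odot> u) p \<in> fib E p" for p
    using sections_fib[OF assms(2)] vector_bundleD(2)[OF E] by (simp add: fun_smult_def subspace_scale)
  fix U \<tau> assume U: "(U, \<tau>) \<in> trv E"
  show "smooth_map_on A U (\<lambda>p. \<tau> p ((f \<odot> u) p))"
  proof (rule smooth_map_on_cong[OF A vector_bundleD(4)[OF E U]])
    show "smooth_map_on A U (\<lambda>p. f p *\<^sub>R \<tau> p (u p))"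
      by (rule smooth_map_on_scaleR[OF Cinf_smooth[OF assms(1)] sections_smooth[OF assms(2) U]])
    show "f p *\<^sub>R \<tau> p (u p) = \<tau> p ((f \<odot> u) p)" if "p \<in> U" for p
      using vector_bundleD(5)[OF E U that] sections_fib[OF assms(2)]
      by (simp add: linear_over_def fun_smult_def)
  qed
qed

lemma sections_add:
  assumes "u \<in> sections A E" "v \<in> sections A E"
  shows "u + v \<in> sections A E"
proof (rule sectionsI)
  show "(u + v) p \<in> fib E p" for p
    using assms sections_fib vector_bundleD(2)[OF E] by (simp add: subspace_add sections_fib)
  fix U \<tau> assume U: "(U, \<tau>) \<in> trv E"
  show "smooth_map_on A U (\<lambda>p. \<tau> p ((u + v) p))"
  proof (rule smooth_map_on_cong[OF A vector_bundleD(4)[OF E U]])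
    show "smooth_map_on A U (\<lambda>p. \<tau> p (u p) + \<tau> p (v p))"
      by (rule smooth_map_on_add[OF sections_smooth[OF assms(1) U] sections_smooth[OF assms(2) U]])
    show "\<tau> p (u p) + \<tau> p (v p) = \<tau> p ((u + v) p)" if "p \<in> U" for p
      using vector_bundleD(5)[OF E U that] sections_fib[OF assms(1)] sections_fib[OF assms(2)]
      by (simp add: linear_over_def)
  qed
qed

lemma sections_0: "0 \<in> sections A E"
proof (rule sectionsI)
  show "0 p \<in> fib E p" for p
    using vector_bundleD(2)[OF E] by (simp add: subspace_0)
  fix U \<tau> assume U: "(U, \<tau>) \<in> trv E"
  show "smooth_map_on A U (\<lambda>p. \<tau> p (0 p))"
    by (rule smooth_map_on_cong[OF A vector_bundleD(4)[OF E U] _ smooth_map_on_const[of A U 0]])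
      (simp add: linear_over_0[OF vector_bundleD(2)[OF E] vector_bundleD(5)[OF E U]])
qed

lemma sections_scaleR:
  assumes "u \<in> sections A E"
  shows "c *\<^sub>R u \<in> sections A E"
proof -
  have "(\<lambda>_. c) \<odot> u \<in> sections A E"
    by (rule sections_smult[OF _ assms]) (simp add: Cinf_def smooth_map_on_const)
  then show ?thesis by (simp add: fun_smult_def scaleR_fun_def)
qed

lemma subspace_sections: "subspace (sections A E)"
  by (simp add: subspace_def sections_0 sections_add sections_scaleR)

text \<open>The sheaf property. It is meant for the contraction, which is defined point by point and
  is recognised as a section only through its agreement with sections near each point.\<close>

lemma sections_glue:
  assumes "\<And>p. \<exists>W s. open W \<and> p \<in> W \<and> s \<in> sections A E \<and> (\<forall>q\<in>W. u q = s q)"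
  shows "u \<in> sections A E"
proof -
  obtain W s where W: "\<And>p. open (W p)" "\<And>p. p \<in> W p"
    and s: "\<And>p. s p \<in> sections A E" "\<And>p q. q \<in> W p \<Longrightarrow> u q = s p q"
    using assms by metis
  show ?thesis
  proof (rule sectionsI)
    show "u p \<in> fib E p" for p
      using s(2)[OF W(2)] sections_fib[OF s(1)] by metis
    fix U \<tau> assume U: "(U, \<tau>) \<in> trv E"
    have "smooth_map_on A (\<Union>p\<in>UNIV. U \<inter> W p) (\<lambda>p. \<tau> p (u p))"
    proof (rule smooth_map_on_UN[OF A])
      fix p
      show o: "open (U \<inter> W p)" using vector_bundleD(4)[OF E U] W(1) by blast
      have "smooth_map_on A (U \<inter> W p) (\<lambda>q. \<tau> q (s p q))"
        using sections_smooth[OF s(1) U] by (rule smooth_map_on_subset) simp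
      then show "smooth_map_on A (U \<inter> W p) (\<lambda>p. \<tau> p (u p))"
        by (rule smooth_map_on_cong[OF A o, rotated]) (simp add: s(2)[symmetric])
    qed
    moreover have "(\<Union>p\<in>UNIV. U \<inter> W p) = U" using W(2) by auto
    ultimately show "smooth_map_on A U (\<lambda>p. \<tau> p (u p))" by simp
  qed
qed

text \<open>The section itself may not extend, but its product with a bump function supported in
  \<open>W\<close> does. In a trivialisation over \<open>U\<close>, the extension is smooth on
  \<open>U \<inter> W\<close> as a product and on \<open>U \<inter> - K\<close> as zero, and these
  two open sets cover \<open>U\<close>.\<close>

lemma local_section_extend:
  assumes W: "open W" "p \<in> W" and s: "local_section A E W s"
  obtains s' N where "s' \<in> sections A E" "open N" "p \<in> N" "N \<subseteq> W" "\<And>q. q \<in> N \<Longrightarrow> s' q = s q"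
proof -
  obtain \<beta> N K where \<beta>: "\<beta> \<in> Cinf A" and N: "open N" "p \<in> N" and K: "closed K" "N \<subseteq> K" "K \<subseteq> W"
    and \<beta>1: "\<And>q. q \<in> N \<Longrightarrow> \<beta> q = 1" and \<beta>0: "\<And>q. q \<notin> K \<Longrightarrow> \<beta> q = 0"
    using bump_function_exists[OF A W] by metis
  define s' where "s' q = (if q \<in> W then \<beta> q *\<^sub>R s q else 0)" for q
  have fib: "s q \<in> fib E q" if "q \<in> W" for q
    using s that by (simp add: local_section_def)
  have "s' \<in> sections A E"
  proof (rule sectionsI)
    show "s' q \<in> fib E q" for q
      using fib vector_bundleD(2)[OF E] by (simp add: s'_def subspace_scale subspace_0)
    fix U \<tau> assume U: "(U, \<tau>) \<in> trv E"
    have oU: "open U" using vector_bundleD(4)[OF E U] .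
    have "smooth_map_on A (U \<inter> W) (\<lambda>q. \<tau> q (s q))"
      using s U by (auto simp: local_section_def)
    then have "smooth_map_on A (U \<inter> W) (\<lambda>q. \<beta> q *\<^sub>R \<tau> q (s q))"
      by (rule smooth_map_on_scaleR[OF Cinf_smooth[OF \<beta>]])
    then have 1: "smooth_map_on A (U \<inter> W) (\<lambda>q. \<tau> q (s' q))"
      by (rule smooth_map_on_cong[OF A _ _, rotated 2])
        (use oU W fib vector_bundleD(5)[OF E U] in \<open>auto simp: s'_def linear_over_def\<close>)
    have zero: "s' q = 0" if "q \<notin> K" for q using \<beta>0[OF that] by (simp add: s'_def)
    have 2: "smooth_map_on A (U \<inter> - K) (\<lambda>q. \<tau> q (s' q))"
      by (rule smooth_map_on_cong[OF A _ _ smooth_map_on_const[of A _ 0]])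
        (use oU K zero linear_over_0[OF vector_bundleD(2)[OF E] vector_bundleD(5)[OF E U]]
          in auto)
    have "smooth_map_on A ((U \<inter> W) \<union> (U \<inter> - K)) (\<lambda>q. \<tau> q (s' q))"
      by (rule smooth_map_on_Un[OF A _ _ 1 2]) (use oU W K in auto)
    moreover have "(U \<inter> W) \<union> (U \<inter> - K) = U" using K by auto
    ultimately show "smooth_map_on A U (\<lambda>q. \<tau> q (s' q))" by simp
  qed
  moreover have "s' q = s q" if "q \<in> N" for q
  proof -
    have "q \<in> W" using that K by auto
    then show ?thesis using \<beta>1[OF that] by (simp add: s'_def)
  qed
  moreover have "N \<subseteq> W" using K by simp
  ultimately show thesis using that[of s' N] N by simp
qed

text \<open>Constant coordinates in one trivialisation are smooth in every other by the smoothness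
  of the transition maps. Applied to \<open>E\<close> and to its dual, this produces frames and
  coframes.\<close>

lemma constant_local_section:
  assumes U: "(U, \<tau>) \<in> trv E"
  shows "local_section A E U (\<lambda>p. inv_into (fib E p) (\<tau> p) c)"
  unfolding local_section_def
proof (intro conjI ballI)
  show "inv_into (fib E p) (\<tau> p) c \<in> fib E p" if "p \<in> U" for p
    using vector_bundleD(6)[OF E U that] by (simp add: bij_betw_def inv_into_into)
  show "case x of (V, \<sigma>) \<Rightarrow>
      smooth_map_on A (V \<inter> U) (\<lambda>p. \<sigma> p (inv_into (fib E p) (\<tau> p) c))" if "x \<in> trv E" for x
    using vector_bundleD(7)[OF E U] that by (auto simp: Int_commute)
qed

text \<open>With a bump function \<open>\<beta>\<close> supported in \<open>W\<close>, the products
  of \<open>\<beta>\<close> with \<open>s\<close> and with \<open>t\<close> are the same global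
  section. Linearity moves \<open>\<beta>\<close> outside \<open>h\<close>, where it equals 1 at
  \<open>p\<close>.\<close>

lemma Cinf_linear_on_local:
  assumes h: "Cinf_linear_on A (sections A E) h" and W: "open W" "p \<in> W"
    and s: "s \<in> sections A E" "t \<in> sections A E" "\<And>q. q \<in> W \<Longrightarrow> s q = t q"
  shows "h s p = h t p"
proof -
  obtain \<beta> N K where \<beta>: "\<beta> \<in> Cinf A" and N: "p \<in> N" and K: "K \<subseteq> W"
    and \<beta>1: "\<And>q. q \<in> N \<Longrightarrow> \<beta> q = 1" and \<beta>0: "\<And>q. q \<notin> K \<Longrightarrow> \<beta> q = 0"
    using bump_function_exists[OF A W] by metis
  have eq: "\<beta> q *\<^sub>R s q = \<beta> q *\<^sub>R t q" for q
  proof (cases "q \<in> K")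
    case True
    then have "q \<in> W" using K by auto
    then show ?thesis using s(3) by simp
  qed (simp add: \<beta>0)
  have "\<beta> \<odot> s = \<beta> \<odot> t" by (simp only: fun_smult_def eq)
  then have "\<beta> \<odot> h s = \<beta> \<odot> h t"
    using h \<beta> s(1,2) unfolding Cinf_linear_on_def by metis
  then have "(\<beta> \<odot> h s) p = (\<beta> \<odot> h t) p" by simp
  then show ?thesis using \<beta>1[OF N] by (simp add: fun_smult_def)
qed

lemma Cinf_linear_on_0:
  assumes "Cinf_linear_on A (sections A E) h"
  shows "h 0 = 0"
proof -
  have "h (0 + 0) = h 0 + h 0" using assms sections_0 unfolding Cinf_linear_on_def by blast
  then show ?thesis by simp
qed

lemma Cinf_linear_on_sum:
  assumes h: "Cinf_linear_on A (sections A E) h"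
    and u: "\<And>i. i \<in> I \<Longrightarrow> u i \<in> sections A E"
  shows "h (\<Sum>i\<in>I. u i) = (\<Sum>i\<in>I. h (u i))"
  using u
proof (induction I rule: infinite_finite_induct)
  case (insert i I)
  have "(\<Sum>i\<in>I. u i) \<in> sections A E" "u i \<in> sections A E"
    using insert.prems by (simp_all add: subspace_sum[OF subspace_sections])
  then have "h (u i + (\<Sum>i\<in>I. u i)) = h (u i) + h (\<Sum>i\<in>I. u i)"
    using h unfolding Cinf_linear_on_def by blast
  also have "h (\<Sum>i\<in>I. u i) = (\<Sum>i\<in>I. h (u i))"
    using insert by blast
  finally show ?case
    unfolding sum.insert[OF insert.hyps] .
qed (simp_all add: Cinf_linear_on_0[OF h])

end

section \<open>Frames and contractions\<close>

text \<open>The coefficients are attached to the indices rather than to the vectors in the image,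
  which is the form needed for sums over a frame.\<close>

lemma span_image_finite_expansion:
  assumes "finite I" "x \<in> span (f ` I)"
  obtains c where "x = (\<Sum>i\<in>I. c i *\<^sub>R f i)"
proof -
  let ?S = "range (\<lambda>c. \<Sum>i\<in>I. c i *\<^sub>R f i)"
  have "subspace ?S"
    unfolding subspace_def
  proof (intro conjI ballI allI)
    show "0 \<in> ?S" by (rule range_eqI[of _ _ "\<lambda>_. 0"]) simp
    fix x assume "x \<in> ?S"
    then obtain c where c: "x = (\<Sum>i\<in>I. c i *\<^sub>R f i)" by auto
    show "r *\<^sub>R x \<in> ?S" for r
      by (rule range_eqI[of _ _ "\<lambda>i. r * c i"]) (simp add: c scaleR_sum_right)
    fix y assume "y \<in> ?S"
    then obtain c' where c': "y = (\<Sum>i\<in>I. c' i *\<^sub>R f i)" by auto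
    show "x + y \<in> ?S"
      by (rule range_eqI[of _ _ "\<lambda>i. c i + c' i"])
        (simp add: c c' scaleR_add_left sum.distrib)
  qed
  moreover have "f ` I \<subseteq> ?S"
  proof clarify
    fix j assume "j \<in> I"
    then show "f j \<in> ?S"
      using assms(1)
      by (intro range_eqI[of _ _ "\<lambda>i. if i = j then 1 else 0"])
        (simp add: if_distrib[of "\<lambda>t. t *\<^sub>R _"] cong: if_cong)
  qed
  ultimately have "x \<in> ?S" using span_minimal assms(2) by blast
  then show thesis using that by auto
qed

text \<open>This is the premise of the definite description in \<open>frame_contraction\<close>. The
  local frame is quantified away because the sum there mentions only the global sections.\<close>

definition extended_frame ::
    "('m::topological_space, 'b::real_inner) atlas \<Rightarrow> ('m, 'v::real_vector, 'f::real_inner) vbundle \<Rightarrow>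
     'm \<Rightarrow> (nat \<Rightarrow> 'm \<Rightarrow> 'v) \<Rightarrow> (nat \<Rightarrow> 'm \<Rightarrow> 'v \<Rightarrow> real) \<Rightarrow> bool"
  where "extended_frame A E p X' e' \<longleftrightarrow> (\<exists>U X e.
    local_frame A E U X \<and> dual_coframe A E U X e \<and> p \<in> U \<and>
    (\<forall>a<vb_rank E. X' a \<in> sections A E \<and> e' a \<in> sections A (dual_bundle E) \<and>
       (\<forall>\<^sub>F q in nhds p. X' a q = X a q \<and> e' a q = e a q)))"

text \<open>Frame independence makes the sum a solution of the description. The existence of an
  extended frame makes it the only one, since otherwise every \<open>y\<close> would qualify
  vacuously.\<close>

lemma frame_contraction_eq:
  assumes "extended_frame A E p X e"
    and "\<And>Y f. extended_frame A E p Y f \<Longrightarrow>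
      (\<Sum>a<vb_rank E. B (f a) (Y a) p) = (\<Sum>a<vb_rank E. B (e a) (X a) p)"
  shows "frame_contraction A E B p = (\<Sum>a<vb_rank E. B (e a) (X a) p)"
  unfolding frame_contraction_def
proof (rule the_equality)
  show "\<forall>U X' e' Y f. local_frame A E U X' \<and> dual_coframe A E U X' e' \<and> p \<in> U \<and>
      (\<forall>a<vb_rank E. Y a \<in> sections A E \<and> f a \<in> sections A (dual_bundle E) \<and>
        (\<forall>\<^sub>F q in nhds p. Y a q = X' a q \<and> f a q = e' a q)) \<longrightarrow>
      (\<Sum>a<vb_rank E. B (e a) (X a) p) = (\<Sum>a<vb_rank E. B (f a) (Y a) p)"
    by (intro allI impI, rule assms(2)[symmetric], unfold extended_frame_def) (intro exI)
next
  fix y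
  assume y: "\<forall>U X' e' Y f. local_frame A E U X' \<and> dual_coframe A E U X' e' \<and> p \<in> U \<and>
      (\<forall>a<vb_rank E. Y a \<in> sections A E \<and> f a \<in> sections A (dual_bundle E) \<and>
        (\<forall>\<^sub>F q in nhds p. Y a q = X' a q \<and> f a q = e' a q)) \<longrightarrow>
      y = (\<Sum>a<vb_rank E. B (f a) (Y a) p)"
  show "y = (\<Sum>a<vb_rank E. B (e a) (X a) p)"
    using assms(1) unfolding extended_frame_def by (elim exE) (rule y[rule_format])
qed

lemma extended_frame_sections:
  assumes "extended_frame A E p X e" "a < vb_rank E"
  shows "X a \<in> sections A E" "e a \<in> sections A (dual_bundle E)"
  using assms by (auto simp: extended_frame_def)

text \<open>Finitely many agreements near \<open>p\<close> hold on a common neighbourhood. An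
  expansion at \<open>p\<close> alone would not do: locality of linear maps compares sections on an
  open set.\<close>

lemma extended_frame_expansion:
  fixes E :: "('m::{t2_space, second_countable_topology}, 'v::real_vector, 'f::real_inner) vbundle"
  assumes E: "vector_bundle A E" and frame: "extended_frame A E p X e"
  obtains N where "open N" "p \<in> N"
    "\<And>q x. q \<in> N \<Longrightarrow> x \<in> fib E q \<Longrightarrow> x = (\<Sum>a<vb_rank E. e a q x *\<^sub>R X a q)"
    "\<And>q a b. q \<in> N \<Longrightarrow> a < vb_rank E \<Longrightarrow> b < vb_rank E \<Longrightarrow>
      e a q (X b q) = (if a = b then 1 else 0)"
proof -
  obtain U X' e' where U: "local_frame A E U X'" "dual_coframe A E U X' e'" "p \<in> U"
    and ev: "\<And>a. a < vb_rank E \<Longrightarrow> \<forall>\<^sub>F q in nhds p. X a q = X' a q \<and> e a q = e' a q"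
    using frame unfolding extended_frame_def by blast
  have "\<forall>\<^sub>F q in nhds p. \<forall>a\<in>{..<vb_rank E}. X a q = X' a q \<and> e a q = e' a q"
    using ev by (intro eventually_ball_finite) auto
  moreover have "\<forall>\<^sub>F q in nhds p. q \<in> U"
    using U by (intro eventually_nhds_in_open) (auto simp: local_frame_def)
  ultimately have "\<forall>\<^sub>F q in nhds p.
      q \<in> U \<and> (\<forall>a\<in>{..<vb_rank E}. X a q = X' a q \<and> e a q = e' a q)"
    by (simp add: eventually_conj)
  then obtain N where N: "open N" "p \<in> N"
    and NU: "\<And>q. q \<in> N \<Longrightarrow> q \<in> U"
    and eq: "\<And>q a. q \<in> N \<Longrightarrow> a < vb_rank E \<Longrightarrow> X a q = X' a q \<and> e a q = e' a q"
    unfolding eventually_nhds by auto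
  have delta: "e a q (X b q) = (if a = b then 1 else 0)"
    if "q \<in> N" "a < vb_rank E" "b < vb_rank E" for q a b
    using eq NU that U(2) by (simp add: dual_coframe_def)
  have "x = (\<Sum>a<vb_rank E. e a q x *\<^sub>R X a q)" if q: "q \<in> N" and x: "x \<in> fib E q" for q x
  proof -
    have "span ((\<lambda>a. X' a q) ` {..<vb_rank E}) = fib E q"
      using U(1) NU[OF q] by (simp add: local_frame_def)
    moreover have "(\<lambda>a. X' a q) ` {..<vb_rank E} = (\<lambda>a. X a q) ` {..<vb_rank E}"
      using eq[OF q] by (intro image_cong) auto
    ultimately have "x \<in> span ((\<lambda>a. X a q) ` {..<vb_rank E})" using x by simp
    then obtain c where c: "x = (\<Sum>b<vb_rank E. c b *\<^sub>R X b q)"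
      by (rule span_image_finite_expansion[OF finite_lessThan])
    have "e a q x = c a" if a: "a < vb_rank E" for a
    proof -
      have "linear_over (fib E q) (e a q)"
        using sections_fib[OF extended_frame_sections(2)[OF frame a], of q]
        by (simp add: dual_bundle_simps dual_space_def)
      then have "e a q x = (\<Sum>b<vb_rank E. c b *\<^sub>R e a q (X b q))"
        unfolding c using sections_fib[OF extended_frame_sections(1)[OF frame]]
        by (intro linear_over_sum[OF vector_bundleD(2)[OF E]]) auto
      also have "\<dots> = (\<Sum>b<vb_rank E. if a = b then c b else 0)"
        using a by (intro sum.cong) (auto simp: delta[OF q])
      finally show ?thesis using a by simp
    qed
    then show ?thesis using c by simp
  qed
  then show thesis using that[of N] N delta by blast
qed

section \<open>Existence of extended frames and expansions in them\<close>

context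
  fixes A :: "('m::{t2_space, second_countable_topology}, 'b::real_inner) atlas"
    and E :: "('m, 'v::real_vector, 'f::real_inner) vbundle"
  assumes A: "smooth_manifold A" and E: "vector_bundle A E"
begin

lemma dual_section_sum:
  assumes "\<omega> \<in> sections A (dual_bundle E)" "\<And>i. i \<in> I \<Longrightarrow> x i \<in> fib E p"
  shows "\<omega> p (\<Sum>i\<in>I. c i *\<^sub>R x i) = (\<Sum>i\<in>I. c i * \<omega> p (x i))"
proof -
  have "linear_over (fib E p) (\<omega> p)"
    using sections_fib[OF assms(1), of p] by (simp add: dual_bundle_simps dual_space_def)
  from linear_over_sum[OF vector_bundleD(2)[OF E] this, of I x c] assms(2)
  show ?thesis by simp
qed

text \<open>The point is uniformity: one choice of global sections serves all \<open>q\<close> near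
  \<open>p\<close>, so that the contraction near \<open>p\<close> is given by a single global
  section.\<close>

lemma extended_frame_exists:
  obtains N X e where "open N" "p \<in> N" "\<And>q. q \<in> N \<Longrightarrow> extended_frame A E q X e"
proof -
  obtain U \<tau> where U: "(U, \<tau>) \<in> trv E" "p \<in> U"
    using vector_bundleD(3)[OF E] by blast
  let ?n = "vb_rank E"
  obtain d :: "nat \<Rightarrow> 'f" and n where n: "n = dim (UNIV :: 'f set)"
    and dd: "\<And>i j. i < n \<Longrightarrow> j < n \<Longrightarrow> d i \<bullet> d j = (if i = j then 1 else 0)"
    and d: "inj_on d {..<n}" "independent (d ` {..<n})" "span (d ` {..<n}) = UNIV"
    by (rule orthonormal_basis_exists[OF vector_bundleD(1)[OF E]], rule that; assumption)
  have n: "n = ?n" using n by (simp add: vb_rank_def)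
  note dd = dd[unfolded n] and d = d[unfolded n]
  define X where "X a q = inv_into (fib E q) (\<tau> q) (d a)" for a q
  \<comment> \<open>The same orthonormal vectors are pulled back through the dual trivialisation, so
    the pairing of coframe and frame is \<open>d a \<bullet> d b\<close>.\<close>
  define e where "e a q = inv_into (fib (dual_bundle E) q) (riesz_vector (fib E q) (\<tau> q)) (d a)"
    for a q
  have oU: "open U" using vector_bundleD(4)[OF E U(1)] .
  have X: "local_section A E U (X a)" for a
    unfolding X_def by (rule constant_local_section[OF A E U(1)])
  have e: "local_section A (dual_bundle E) U (e a)" for a
    unfolding e_def using U(1)
    by (intro constant_local_section[OF A vector_bundle_dual[OF A E]])
      (force simp: dual_bundle_simps)
  have bij: "bij_betw (\<tau> q) (fib E q) UNIV" and lin: "linear (inv_into (fib E q) (\<tau> q))"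
    if "q \<in> U" for q
    using vector_bundleD(6)[OF E U(1) that] linear_inv_into[OF vector_bundleD(2)[OF E]
        vector_bundleD(5)[OF E U(1) that] vector_bundleD(6)[OF E U(1) that]]
    by auto
  have frame: "local_frame A E U X"
    unfolding local_frame_def
  proof (intro conjI allI impI ballI oU X)
    fix q assume q: "q \<in> U"
    let ?g = "inv_into (fib E q) (\<tau> q)"
    have injg: "inj ?g"
      using bij[OF q] by (metis bij_betw_def inj_on_inv_into subset_UNIV)
    have img: "(\<lambda>a. X a q) ` {..<?n} = ?g ` d ` {..<?n}"
      by (simp add: X_def image_image)
    show "inj_on (\<lambda>a. X a q) {..<?n}"
      using comp_inj_on[OF d(1) inj_on_subset[OF injg subset_UNIV]] by (simp add: X_def comp_def)
    show "independent ((\<lambda>a. X a q) ` {..<?n})"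
      unfolding img by (rule linear_independent_injective_image[OF lin[OF q] d(2) inj_on_subset[OF injg subset_UNIV]])
    have "range ?g = fib E q"
      using bij[OF q] by (metis bij_betw_def bij_betw_inv_into)
    then show "span ((\<lambda>a. X a q) ` {..<?n}) = fib E q"
      unfolding img by (simp add: linear_span_image[OF lin[OF q]] d(3))
  qed
  have coframe: "dual_coframe A E U X e"
    unfolding dual_coframe_def
  proof (intro conjI allI impI ballI e)
    fix q a b assume q: "q \<in> U" and ab: "a < ?n" "b < ?n"
    have "e a q = (\<lambda>x. if x \<in> fib E q then d a \<bullet> \<tau> q x else 0)"
      unfolding e_def dual_bundle_simps
      by (rule inv_into_riesz_vector[OF vector_bundleD(2)[OF E] vector_bundleD(5)[OF E U(1) q]
            bij[OF q] vector_bundleD(1)[OF E]])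
    moreover have "X b q \<in> fib E q" "\<tau> q (X b q) = d b"
      using bij[OF q] by (simp_all add: X_def bij_betw_def inv_into_into f_inv_into_f)
    ultimately show "e a q (X b q) = (if a = b then 1 else 0)"
      using dd ab by simp
  qed
  have "\<exists>s N. s \<in> sections A E \<and> open N \<and> p \<in> N \<and> (\<forall>q\<in>N. s q = X a q)" for a
    using local_section_extend[OF A E oU U(2) X] by metis
  then obtain X' NX where X': "\<And>a. X' a \<in> sections A E" "\<And>a. open (NX a)" "\<And>a. p \<in> NX a"
      "\<And>a q. q \<in> NX a \<Longrightarrow> X' a q = X a q"
    by metis
  have "\<exists>s N. s \<in> sections A (dual_bundle E) \<and> open N \<and> p \<in> N \<and> (\<forall>q\<in>N. s q = e a q)" for a
    using local_section_extend[OF A vector_bundle_dual[OF A E] oU U(2) e] by metis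
  then obtain e' Ne where e': "\<And>a. e' a \<in> sections A (dual_bundle E)" "\<And>a. open (Ne a)"
      "\<And>a. p \<in> Ne a" "\<And>a q. q \<in> Ne a \<Longrightarrow> e' a q = e a q"
    by metis
  \<comment> \<open>Each section agrees with its extension on its own neighbourhood; the rank is
    finite, so the intersection is open, and for rank zero it is \<open>U\<close>.\<close>
  define N where "N = U \<inter> (\<Inter>a\<in>{..<?n}. NX a \<inter> Ne a)"
  have N: "open N" "p \<in> N"
    using oU U(2) X' e' unfolding N_def by (auto intro!: open_Int open_INT)
  have "extended_frame A E q X' e'" if q: "q \<in> N" for q
  proof -
    have "\<forall>\<^sub>F r in nhds q. X' a r = X a r \<and> e' a r = e a r" if a: "a < ?n" for a
    proof (rule eventually_mono[OF eventually_nhds_in_open[OF N(1) q]])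
      fix r assume "r \<in> N"
      then have "r \<in> NX a" "r \<in> Ne a" using a by (simp_all add: N_def)
      then show "X' a r = X a r \<and> e' a r = e a r" using X'(4) e'(4) by simp
    qed
    moreover have "q \<in> U" using q by (simp add: N_def)
    ultimately show ?thesis
      unfolding extended_frame_def using frame coframe X'(1) e'(1)
      by (intro exI[of _ U] exI[of _ X] exI[of _ e]) simp
  qed
  then show thesis using that N by blast
qed

text \<open>Over a trivialisation the pairing is the inner product of the coordinates of the two
  sections, by the choice of the dual trivialisation.\<close>

lemma pairing_smooth:
  assumes \<omega>: "\<omega> \<in> sections A (dual_bundle E)" and u: "u \<in> sections A E"
  shows "(\<lambda>p. \<omega> p (u p)) \<in> Cinf A"
proof -
  have "smooth_map_on A (\<Union>(U, \<tau>)\<in>trv E. U) (\<lambda>p. \<omega> p (u p))"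
  proof (rule smooth_map_on_UN[OF A])
    show "open (case x of (U, \<tau>) \<Rightarrow> U)" if "x \<in> trv E" for x
      using vector_bundleD(4)[OF E, of "fst x" "snd x"] that by (simp add: split_beta)
    fix x assume "x \<in> trv E"
    then obtain U \<tau> where U: "(U, \<tau>) \<in> trv E" and x: "x = (U, \<tau>)" by (cases x) auto
    have "(U, \<lambda>p. riesz_vector (fib E p) (\<tau> p)) \<in> trv (dual_bundle E)"
      using U by (force simp: dual_bundle_simps)
    then have "smooth_map_on A U (\<lambda>p. riesz_vector (fib E p) (\<tau> p) (\<omega> p) \<bullet> \<tau> p (u p))"
      by (rule smooth_map_on_inner[OF sections_smooth[OF \<omega>] sections_smooth[OF u U]])
    then have "smooth_map_on A U (\<lambda>p. \<omega> p (u p))"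
    proof (rule smooth_map_on_cong[OF A vector_bundleD(4)[OF E U], rotated])
      fix p assume p: "p \<in> U"
      show "riesz_vector (fib E p) (\<tau> p) (\<omega> p) \<bullet> \<tau> p (u p) = \<omega> p (u p)"
        using riesz_vector_inner[OF vector_bundleD(2)[OF E] vector_bundleD(5)[OF E U p]
            vector_bundleD(6)[OF E U p] vector_bundleD(1)[OF E] _ sections_fib[OF u], of "\<omega> p"]
          sections_fib[OF \<omega>, of p]
        by (simp add: dual_bundle_simps)
    qed
    then show "smooth_map_on A (case x of (U, \<tau>) \<Rightarrow> U) (\<lambda>p. \<omega> p (u p))" by (simp add: x)
  qed
  moreover have "(\<Union>(U, \<tau>)\<in>trv E. U) = UNIV"
    using E unfolding vector_bundle_def by (elim conjE)
  ultimately show ?thesis by (simp add: Cinf_def)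
qed

text \<open>The coefficients \<open>e a q (s q)\<close> are smooth on the whole base, so their
  combination with the \<open>X a\<close> is a global section. It equals \<open>s\<close> only near
  \<open>p\<close>, which is enough because \<open>h\<close> is a local operator.\<close>

lemma Cinf_linear_on_frame_expansion:
  assumes frame: "extended_frame A E p X e"
    and h: "Cinf_linear_on A (sections A E) h" and s: "s \<in> sections A E"
  shows "h s p = (\<Sum>a<vb_rank E. e a p (s p) *\<^sub>R h (X a) p)"
proof -
  obtain N where N: "open N" "p \<in> N"
    "\<And>q x. q \<in> N \<Longrightarrow> x \<in> fib E q \<Longrightarrow> x = (\<Sum>a<vb_rank E. e a q x *\<^sub>R X a q)"
    using extended_frame_expansion[OF E frame] by metis
  note sec = extended_frame_sections[OF frame]
  define c where "c a = (\<lambda>q. e a q (s q))" for a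
  have c: "c a \<in> Cinf A" if "a < vb_rank E" for a
    unfolding c_def by (rule pairing_smooth[OF sec(2)[OF that] s])
  have cX: "c a \<odot> X a \<in> sections A E" if "a \<in> {..<vb_rank E}" for a
    using sections_smult[OF A E c sec(1)] that by simp
  have "h s p = h (\<Sum>a<vb_rank E. c a \<odot> X a) p"
  proof (rule Cinf_linear_on_local[OF A E h N(1,2) s])
    show "(\<Sum>a<vb_rank E. c a \<odot> X a) \<in> sections A E"
      by (rule subspace_sum[OF subspace_sections[OF A E] cX])
    show "s q = (\<Sum>a<vb_rank E. c a \<odot> X a) q" if "q \<in> N" for q
      by (simp add: sum_fun_apply fun_smult_def c_def N(3)[OF that sections_fib[OF s], symmetric])
  qed
  also have "\<dots> = (\<Sum>a<vb_rank E. h (c a \<odot> X a)) p"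
    by (rule arg_cong[where f = "\<lambda>g. g p"], rule Cinf_linear_on_sum[OF A E h cX])
  also have "\<dots> = (\<Sum>a<vb_rank E. e a p (s p) *\<^sub>R h (X a) p)"
    unfolding sum_fun_apply
  proof (rule sum.cong)
    fix a assume "a \<in> {..<vb_rank E}"
    then have "h (c a \<odot> X a) = c a \<odot> h (X a)"
      using h c sec(1) unfolding Cinf_linear_on_def by simp
    then show "h (c a \<odot> X a) p = e a p (s p) *\<^sub>R h (X a) p"
      by (simp add: fun_smult_def c_def)
  qed simp
  finally show ?thesis .
qed

lemma Cinf_linear_on_coframe_expansion:
  assumes frame: "extended_frame A E p X e"
    and h: "Cinf_linear_on A (sections A (dual_bundle E)) h"
    and \<omega>: "\<omega> \<in> sections A (dual_bundle E)"
  shows "h \<omega> p = (\<Sum>a<vb_rank E. \<omega> p (X a p) *\<^sub>R h (e a) p)"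
proof -
  note E' = vector_bundle_dual[OF A E]
  obtain N where N: "open N" "p \<in> N"
    "\<And>q x. q \<in> N \<Longrightarrow> x \<in> fib E q \<Longrightarrow> x = (\<Sum>a<vb_rank E. e a q x *\<^sub>R X a q)"
    using extended_frame_expansion[OF E frame] by metis
  note sec = extended_frame_sections[OF frame]
  define c where "c a = (\<lambda>q. \<omega> q (X a q))" for a
  have c: "c a \<in> Cinf A" if "a < vb_rank E" for a
    unfolding c_def by (rule pairing_smooth[OF \<omega> sec(1)[OF that]])
  have ce: "c a \<odot> e a \<in> sections A (dual_bundle E)" if "a \<in> {..<vb_rank E}" for a
    using sections_smult[OF A E' c sec(2)] that by simp
  have "h \<omega> p = h (\<Sum>a<vb_rank E. c a \<odot> e a) p"
  proof (rule Cinf_linear_on_local[OF A E' h N(1,2) \<omega>])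
    show "(\<Sum>a<vb_rank E. c a \<odot> e a) \<in> sections A (dual_bundle E)"
      by (rule subspace_sum[OF subspace_sections[OF A E'] ce])
    fix q assume q: "q \<in> N"
    \<comment> \<open>Equality of functionals is tested on the whole ambient vector space; outside
      the fibre both sides are zero by the convention for \<open>dual_bundle\<close>.\<close>
    have zero: "\<alpha> q x = 0" if "\<alpha> \<in> sections A (dual_bundle E)" "x \<notin> fib E q" for \<alpha> x
      using sections_fib[OF that(1), of q] that(2) by (simp add: dual_bundle_simps dual_space_def)
    have exp: "\<omega> q x = (\<Sum>a<vb_rank E. \<omega> q (X a q) * e a q x)" for x
    proof (cases "x \<in> fib E q")
      case True
      have "\<omega> q x = \<omega> q (\<Sum>a<vb_rank E. e a q x *\<^sub>R X a q)"
        by (simp only: N(3)[OF q True, symmetric])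
      also have "\<dots> = (\<Sum>a<vb_rank E. e a q x * \<omega> q (X a q))"
        by (rule dual_section_sum[OF \<omega>]) (simp add: sections_fib[OF sec(1)])
      finally show ?thesis by (simp only: mult.commute)
    next
      case False
      then show ?thesis by (simp add: zero[OF \<omega>] zero[OF sec(2)])
    qed
    show "\<omega> q = (\<Sum>a<vb_rank E. c a \<odot> e a) q"
    proof
      fix x
      have "(\<Sum>a<vb_rank E. c a \<odot> e a) q x = (\<Sum>a<vb_rank E. \<omega> q (X a q) * e a q x)"
        by (simp only: sum_fun_apply fun_smult_def c_def scaleR_fun_def real_scaleR_def)
      with exp show "\<omega> q x = (\<Sum>a<vb_rank E. c a \<odot> e a) q x" by (rule trans[OF _ sym])
    qed
  qed
  also have "\<dots> = (\<Sum>a<vb_rank E. h (c a \<odot> e a)) p"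
    by (rule arg_cong[where f = "\<lambda>g. g p"], rule Cinf_linear_on_sum[OF A E' h ce])
  also have "\<dots> = (\<Sum>a<vb_rank E. \<omega> p (X a p) *\<^sub>R h (e a) p)"
    unfolding sum_fun_apply
  proof (rule sum.cong)
    fix a assume "a \<in> {..<vb_rank E}"
    then have "h (c a \<odot> e a) = c a \<odot> h (e a)"
      using h c sec(2) unfolding Cinf_linear_on_def by simp
    then show "h (c a \<odot> e a) p = \<omega> p (X a p) *\<^sub>R h (e a) p"
      by (simp add: fun_smult_def c_def)
  qed simp
  finally show ?thesis .
qed

section \<open>Contraction of bilinear maps\<close>

definition Cinf_bilinear :: "(('m \<Rightarrow> 'v \<Rightarrow> real) \<Rightarrow> ('m \<Rightarrow> 'v) \<Rightarrow> 'm \<Rightarrow> 'v) \<Rightarrow> bool"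
  where "Cinf_bilinear B \<longleftrightarrow>
    (\<forall>\<omega>\<in>sections A (dual_bundle E). \<forall>u\<in>sections A E. B \<omega> u \<in> sections A E) \<and>
    (\<forall>\<omega>\<in>sections A (dual_bundle E). Cinf_linear_on A (sections A E) (B \<omega>)) \<and>
    (\<forall>u\<in>sections A E. Cinf_linear_on A (sections A (dual_bundle E)) (\<lambda>\<omega>. B \<omega> u))"

text \<open>Expanding \<open>Y b\<close> in the frame \<open>X\<close> and \<open>f b\<close> in the
  coframe \<open>e\<close> produces the two change-of-frame matrices. They are inverse to each
  other, as one sees by expanding \<open>X a p\<close> in \<open>Y\<close> and applying
  \<open>e c\<close>.\<close>

lemma contraction_frame_independent:
  assumes B: "Cinf_bilinear B"
    and X: "extended_frame A E p X e" and Y: "extended_frame A E p Y f"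
  shows "(\<Sum>b<vb_rank E. B (f b) (Y b) p) = (\<Sum>a<vb_rank E. B (e a) (X a) p)"
proof -
  let ?n = "vb_rank E"
  note secX = extended_frame_sections[OF X] and secY = extended_frame_sections[OF Y]
  have delta: "e a p (X b p) = (if a = b then 1 else 0)" if "a < ?n" "b < ?n" for a b
    using that by (rule_tac extended_frame_expansion[OF E X]) blast
  have expansion: "x = (\<Sum>b<?n. f b p x *\<^sub>R Y b p)" if "x \<in> fib E p" for x
    using that by (rule_tac extended_frame_expansion[OF E Y]) blast
  have inverse: "(\<Sum>b<?n. e c p (Y b p) * f b p (X a p)) = (if c = a then 1 else 0)"
    if ac: "a < ?n" "c < ?n" for a c
  proof -
    have "e c p (\<Sum>b<?n. f b p (X a p) *\<^sub>R Y b p) = (\<Sum>b<?n. f b p (X a p) * e c p (Y b p))"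
      by (rule dual_section_sum[OF secX(2)[OF ac(2)]]) (simp add: sections_fib[OF secY(1)])
    moreover have "(\<Sum>b<?n. f b p (X a p) *\<^sub>R Y b p) = X a p"
      by (rule expansion[OF sections_fib[OF secX(1)[OF ac(1)]], symmetric])
    ultimately show ?thesis using delta[OF ac(2,1)] by (simp add: mult.commute)
  qed
  have Bdual: "Cinf_linear_on A (sections A E) (B \<omega>)"
    if "\<omega> \<in> sections A (dual_bundle E)" for \<omega>
    using B that unfolding Cinf_bilinear_def by blast
  have Bsec: "Cinf_linear_on A (sections A (dual_bundle E)) (\<lambda>\<omega>. B \<omega> u)"
    if "u \<in> sections A E" for u
    using B that unfolding Cinf_bilinear_def by blast
  have "B (f b) (Y b) p =
      (\<Sum>c<?n. \<Sum>a<?n. (e c p (Y b p) * f b p (X a p)) *\<^sub>R B (e a) (X c) p)" if b: "b < ?n" for b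
  proof -
    have "B (f b) (Y b) p = (\<Sum>c<?n. e c p (Y b p) *\<^sub>R B (f b) (X c) p)"
      by (rule Cinf_linear_on_frame_expansion[OF X Bdual[OF secY(2)[OF b]] secY(1)[OF b]])
    also have "\<dots> = (\<Sum>c<?n. e c p (Y b p) *\<^sub>R (\<Sum>a<?n. f b p (X a p) *\<^sub>R B (e a) (X c) p))"
    proof (rule sum.cong)
      fix c assume "c \<in> {..<?n}"
      then have "X c \<in> sections A E" by (simp add: secX(1))
      from Cinf_linear_on_coframe_expansion[OF X Bsec[OF this] secY(2)[OF b]]
      have "B (f b) (X c) p = (\<Sum>a<?n. f b p (X a p) *\<^sub>R B (e a) (X c) p)" .
      then show "e c p (Y b p) *\<^sub>R B (f b) (X c) p =
          e c p (Y b p) *\<^sub>R (\<Sum>a<?n. f b p (X a p) *\<^sub>R B (e a) (X c) p)" by simp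
    qed simp
    finally show ?thesis by (simp add: scaleR_sum_right)
  qed
  then have "(\<Sum>b<?n. B (f b) (Y b) p) =
      (\<Sum>b<?n. \<Sum>c<?n. \<Sum>a<?n. (e c p (Y b p) * f b p (X a p)) *\<^sub>R B (e a) (X c) p)"
    by simp
  \<comment> \<open>The sum over \<open>b\<close> is moved innermost, where it forms the matrix
    product that equals the identity.\<close>
  also have "\<dots> = (\<Sum>c<?n. \<Sum>b<?n. \<Sum>a<?n. (e c p (Y b p) * f b p (X a p)) *\<^sub>R B (e a) (X c) p)"
    by (rule sum.swap)
  also have "\<dots> = (\<Sum>c<?n. \<Sum>a<?n. \<Sum>b<?n. (e c p (Y b p) * f b p (X a p)) *\<^sub>R B (e a) (X c) p)"
    by (rule sum.cong[OF refl], rule sum.swap)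
  also have "\<dots> = (\<Sum>c<?n. \<Sum>a<?n. (\<Sum>b<?n. e c p (Y b p) * f b p (X a p)) *\<^sub>R B (e a) (X c) p)"
    by (simp add: scaleR_sum_left)
  also have "\<dots> = (\<Sum>c<?n. \<Sum>a<?n. if c = a then B (e a) (X c) p else 0)"
  proof (intro sum.cong[OF refl])
    fix c a assume "c \<in> {..<?n}" "a \<in> {..<?n}"
    then show "(\<Sum>b<?n. e c p (Y b p) * f b p (X a p)) *\<^sub>R B (e a) (X c) p =
        (if c = a then B (e a) (X c) p else 0)"
      using inverse[of a c] by simp
  qed
  also have "\<dots> = (\<Sum>c<?n. B (e c) (X c) p)"
    by (rule sum.cong[OF refl]) simp
  finally show ?thesis .
qed

lemma frame_contraction_extended_frame:
  assumes "Cinf_bilinear B" "extended_frame A E p X e"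
  shows "frame_contraction A E B p = (\<Sum>a<vb_rank E. B (e a) (X a) p)"
  using assms by (intro frame_contraction_eq contraction_frame_independent)

text \<open>One family of global sections is an extended frame at every point of \<open>N\<close>,
  so the pointwise definite descriptions all evaluate on the same sum.\<close>

lemma frame_contraction_locally_global:
  assumes B: "Cinf_bilinear B"
  obtains N X e where "open N" "p \<in> N" "\<And>q. q \<in> N \<Longrightarrow> extended_frame A E q X e"
    "\<And>a. a < vb_rank E \<Longrightarrow> B (e a) (X a) \<in> sections A E"
    "(\<Sum>a<vb_rank E. B (e a) (X a)) \<in> sections A E"
    "\<And>q. q \<in> N \<Longrightarrow> frame_contraction A E B q = (\<Sum>a<vb_rank E. B (e a) (X a)) q"
proof -
  obtain N X e where N: "open N" "p \<in> N" "\<And>q. q \<in> N \<Longrightarrow> extended_frame A E q X e"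
    using extended_frame_exists by blast
  have sec: "B (e a) (X a) \<in> sections A E" if "a < vb_rank E" for a
    using B extended_frame_sections[OF N(3)[OF N(2)] that] by (simp add: Cinf_bilinear_def)
  then have "(\<Sum>a<vb_rank E. B (e a) (X a)) \<in> sections A E"
    by (intro subspace_sum[OF subspace_sections[OF A E]]) auto
  moreover have "frame_contraction A E B q = (\<Sum>a<vb_rank E. B (e a) (X a)) q" if "q \<in> N" for q
    using frame_contraction_extended_frame[OF B N(3)[OF that]] by (simp add: sum_fun_apply)
  ultimately show thesis using that[of N X e] N sec by simp
qed

lemma frame_contraction_section:
  assumes "Cinf_bilinear B"
  shows "frame_contraction A E B \<in> sections A E"
proof (rule sections_glue[OF A E])
  fix p
  show "\<exists>W s. open W \<and> p \<in> W \<and> s \<in> sections A E \<and> (\<forall>q\<in>W. frame_contraction A E B q = s q)"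
    by (rule frame_contraction_locally_global[OF assms, of p]) blast
qed

text \<open>The contraction need not be a sum of global sections on the whole base, so additivity of
  \<open>P\<close> does not apply directly. Locality of \<open>P\<close> replaces it near
  \<open>p\<close> by such a sum, and both contractions are then evaluated on the same extended
  frame.\<close>

lemma Cinf_linear_frame_contraction:
  assumes B: "Cinf_bilinear B" and P: "Cinf_linear_on A (sections A E) P"
    and PB: "Cinf_bilinear (\<lambda>\<omega> u. P (B \<omega> u))"
  shows "P (frame_contraction A E B) = frame_contraction A E (\<lambda>\<omega> u. P (B \<omega> u))"
proof
  fix p
  obtain N X e where N: "open N" "p \<in> N" "\<And>q. q \<in> N \<Longrightarrow> extended_frame A E q X e"
    and sec: "\<And>a. a < vb_rank E \<Longrightarrow> B (e a) (X a) \<in> sections A E"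
    "(\<Sum>a<vb_rank E. B (e a) (X a)) \<in> sections A E"
    and eq: "\<And>q. q \<in> N \<Longrightarrow> frame_contraction A E B q = (\<Sum>a<vb_rank E. B (e a) (X a)) q"
    by (rule frame_contraction_locally_global[OF B, of p], rule that; assumption)
  have "P (frame_contraction A E B) p = P (\<Sum>a<vb_rank E. B (e a) (X a)) p"
    by (rule Cinf_linear_on_local[OF A E P N(1,2) frame_contraction_section[OF B] sec(2) eq])
  also have "\<dots> = (\<Sum>a<vb_rank E. P (B (e a) (X a)) p)"
    using sec(1) by (subst Cinf_linear_on_sum[OF A E P]) (auto simp: sum_fun_apply)
  also have "\<dots> = frame_contraction A E (\<lambda>\<omega> u. P (B \<omega> u)) p"
    using frame_contraction_extended_frame[OF PB N(3)[OF N(2)]] by simp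
  finally show "P (frame_contraction A E B) p = frame_contraction A E (\<lambda>\<omega> u. P (B \<omega> u)) p" .
qed

end

section \<open>The commutator of second covariant derivatives\<close>

lemma Cinf_linear_on_compose:
  assumes "Cinf_linear_on A S g" "Cinf_linear_on A T h" "\<And>u. u \<in> S \<Longrightarrow> g u \<in> T"
  shows "Cinf_linear_on A S (\<lambda>u. h (g u))"
  using assms unfolding Cinf_linear_on_def by simp

theorem proposition3p9:
  fixes A :: "('m::{t2_space, second_countable_topology}, 'b::real_inner) atlas"
    and E :: "('m, 'v::real_vector, 'f::real_inner) vbundle"
    and \<rho> :: "'m \<Rightarrow> 'v \<Rightarrow> ('m \<Rightarrow> real) \<Rightarrow> real"
    and br :: "('m \<Rightarrow> 'v) \<Rightarrow> ('m \<Rightarrow> 'v) \<Rightarrow> 'm \<Rightarrow> 'v"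
    and L :: "('m \<Rightarrow> 'v \<Rightarrow> real) \<Rightarrow> ('m \<Rightarrow> 'v) \<Rightarrow> ('m \<Rightarrow> 'v) \<Rightarrow> 'm \<Rightarrow> 'v"
    and P :: "('m \<Rightarrow> 'v) \<Rightarrow> 'm \<Rightarrow> 'v"
    and nabla :: "('m \<Rightarrow> 'v) \<Rightarrow> ('m \<Rightarrow> 'v) \<Rightarrow> 'm \<Rightarrow> 'v"
    and u v w :: "'m \<Rightarrow> 'v"
  assumes "smooth_manifold A"
    and "local_pre_Leibniz_algebroid A E \<rho> br L"
    and "regular_anchor E \<rho>"
    and "locality_projector A E \<rho> L P"
    and "E_connection A E \<rho> nabla"
    and "u \<in> sections A E" and "v \<in> sections A E" and "w \<in> sections A E"
  shows "second_covariant_derivative nabla u v w - second_covariant_derivative nabla v u w =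
    E_curvature A E br L P nabla u v w
    - nabla (E_torsion A E br L nabla u v) w
    + nabla (L_contraction A E L nabla u v - P (L_contraction A E L nabla u v)) w"
proof -
  let ?\<Gamma> = "sections A E" and ?\<Omega> = "sections A (dual_bundle E)"
  note A = \<open>smooth_manifold A\<close>
    and loc = \<open>local_pre_Leibniz_algebroid A E \<rho> br L\<close>[unfolded local_pre_Leibniz_algebroid_def Let_def]
    and proj = \<open>locality_projector A E \<rho> L P\<close>[unfolded locality_projector_def Let_def]
    and conn = \<open>E_connection A E \<rho> nabla\<close>[unfolded E_connection_def Let_def]
    and uvw = \<open>u \<in> ?\<Gamma>\<close> \<open>v \<in> ?\<Gamma>\<close> \<open>w \<in> ?\<Gamma>\<close>
  have pre: "pre_Leibniz_algebroid A E \<rho> br" using loc by (elim conjE)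
  then have E: "vector_bundle A E" and br: "br u v \<in> ?\<Gamma>"
    using uvw by (simp_all add: pre_Leibniz_algebroid_def anchored_vector_bundle_def Let_def)
  have L: "\<And>\<omega> x y. \<omega> \<in> ?\<Omega> \<Longrightarrow> x \<in> ?\<Gamma> \<Longrightarrow> y \<in> ?\<Gamma> \<Longrightarrow> L \<omega> x y \<in> ?\<Gamma>"
    "\<And>x y. x \<in> ?\<Gamma> \<Longrightarrow> y \<in> ?\<Gamma> \<Longrightarrow> Cinf_linear_on A ?\<Omega> (\<lambda>\<omega>. L \<omega> x y)"
    "\<And>\<omega> y. \<omega> \<in> ?\<Omega> \<Longrightarrow> y \<in> ?\<Gamma> \<Longrightarrow> Cinf_linear_on A ?\<Gamma> (\<lambda>x. L \<omega> x y)"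
    using loc by blast+
  have P: "\<And>x. x \<in> ?\<Gamma> \<Longrightarrow> P x \<in> ?\<Gamma>" "Cinf_linear_on A ?\<Gamma> P"
    using proj by blast+
  have nabla: "\<And>x y. x \<in> ?\<Gamma> \<Longrightarrow> y \<in> ?\<Gamma> \<Longrightarrow> nabla x y \<in> ?\<Gamma>"
    "\<And>y. y \<in> ?\<Gamma> \<Longrightarrow> linear_over ?\<Gamma> (\<lambda>x. nabla x y)"
    "\<And>f x y. f \<in> Cinf A \<Longrightarrow> x \<in> ?\<Gamma> \<Longrightarrow> y \<in> ?\<Gamma> \<Longrightarrow> nabla (f \<odot> x) y = f \<odot> nabla x y"
    using conn by blast+
  \<comment> \<open>The connection is differentiated in its second argument, which is the fixed
    \<open>u\<close>; the contracted variable sits in the first, where \<open>nabla\<close> is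
    linear over functions. Hence \<open>?B\<close> below is bilinear over functions.\<close>
  have nabla_lin: "Cinf_linear_on A ?\<Gamma> (\<lambda>x. nabla x u)"
    using nabla uvw by (simp add: Cinf_linear_on_def linear_over_def)
  let ?B = "\<lambda>\<omega> X. L \<omega> (nabla X u) v"
  have B: "Cinf_bilinear A E ?B"
    unfolding Cinf_bilinear_def[OF A E]
    using L nabla uvw Cinf_linear_on_compose[OF nabla_lin L(3)] by simp
  have PB: "Cinf_bilinear A E (\<lambda>\<omega> X. P (?B \<omega> X))"
    unfolding Cinf_bilinear_def[OF A E]
  proof (intro conjI ballI)
    fix \<omega> X assume "\<omega> \<in> ?\<Omega>" "X \<in> ?\<Gamma>"
    then show "P (?B \<omega> X) \<in> ?\<Gamma>" using B P(1) unfolding Cinf_bilinear_def[OF A E] by blast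
  next
    fix \<omega> assume "\<omega> \<in> ?\<Omega>"
    then show "Cinf_linear_on A ?\<Gamma> (\<lambda>X. P (?B \<omega> X))"
      using B unfolding Cinf_bilinear_def[OF A E]
      by (intro Cinf_linear_on_compose[OF _ P(2), where g = "?B \<omega>"]) blast+
  next
    fix X assume "X \<in> ?\<Gamma>"
    then show "Cinf_linear_on A ?\<Omega> (\<lambda>\<omega>. P (?B \<omega> X))"
      using B unfolding Cinf_bilinear_def[OF A E]
      by (intro Cinf_linear_on_compose[OF _ P(2), where g = "\<lambda>\<omega>. ?B \<omega> X"]) blast+
  qed
  define C where "C = L_contraction A E L nabla u v"
  have C: "C \<in> ?\<Gamma>"
    unfolding C_def L_contraction_def by (rule frame_contraction_section[OF A E B])
  have PC: "L_contraction A E (L_hat P L) nabla u v = P C"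
    unfolding C_def L_contraction_def L_hat_def
    by (rule Cinf_linear_frame_contraction[OF A E B P(2) PB, symmetric])
  note sub = subspace_sections[OF A E]
  have add: "nabla (x + y) w = nabla x w + nabla y w" if "x \<in> ?\<Gamma>" "y \<in> ?\<Gamma>" for x y
    using nabla(2)[OF uvw(3)] that by (simp add: linear_over_def)
  have diff: "nabla (x - y) w = nabla x w - nabla y w" if "x \<in> ?\<Gamma>" "y \<in> ?\<Gamma>" for x y
    using add[of "x - y" y] that subspace_diff[OF sub that] by simp
  have "nabla (E_torsion A E br L nabla u v) w =
      nabla (nabla u v) w - nabla (nabla v u) w - nabla (br u v) w + nabla C w"
    unfolding E_torsion_def C_def[symmetric]
    using add diff subspace_diff[OF sub] nabla(1) uvw br C by simp
  \<comment> \<open>The terms in \<open>br u v\<close> cancel between curvature and torsion, and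
    those in \<open>C\<close> and \<open>P C\<close> add up to zero; what remains are the second
    covariant derivatives.\<close>
  then show ?thesis
    unfolding second_covariant_derivative_def E_curvature_def PC C_def[symmetric]
    using diff[OF C P(1)[OF C]] by simp
qed

end
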